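(* The restriction $\beta_{4,r}|_{C_{B_4}(\sigma_3)}$ of the reduced Burau representation to the centralizer of $\sigma_3$ in $B_4$ is faithful. Moreover, this faithfulness is preserved modulo $p$ for every prime $p$: the composition of $\beta_{4,r}|_{C_{B_4}(\sigma_3)}$ with the reduction map $\mathrm{GL}(3,\mathbb{Z}[t,t^{-1}])\to\mathrm{GL}(3,\mathbb{F}_p[t,t^{-1}])$ is injective. In particular, the reductions modulo $p$ of the matrices $S$ and $TST^{-1}$ generate a free group of rank $2$ for every prime $p$.
   Context: $B_4$ is the braid group on four strands with standard generators $\sigma_1,\sigma_2,\sigma_3$, and $C_{B_4}(\sigma_3)$ is the centralizer of $\sigma_3$ in $B_4$. The reduced Burau representation $\beta_{4,r}:B_4\to\mathrm{GL}(3,\mathbb{Z}[t,t^{-1}])$ is $$\sigma_1\mapsto\begin{pmatrix}-t&1&0\\0&1&0\\0&0&1\end{pmatrix},\quad \sigma_2\mapsto\begin{pmatrix}1&0&0\\t&-t&1\\0&0&1\end{pmatrix},\quad \sigma_3\mapsto\begin{pmatrix}1&0&0\\0&1&0\\0&t&-t\end{pmatrix}.$$ Put $b_1=\sigma_1\sigma_3^{-1}$, $b_2=\sigma_1\sigma_2\sigma_3\sigma_1^{-1}\sigma_2^{-1}\sigma_1^{-1}$, $S=\beta_{4,r}(b_1)$, $T=\beta_{4,r}(b_2)$. *)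

theory Defs
  imports
    "HOL-Analysis.Analysis"
    "HOL-Algebra.Generated_Groups"
    "HOL-Library.Poly_Mapping"
    "Berlekamp_Zassenhaus.Finite_Field"
begin

section \<open>Groups given by generators and relations\<close>

text \<open>The letter \<open>(x, True)\<close> stands for the generator \<open>x\<close> and \<open>(x, False)\<close> for its inverse.\<close>

type_synonym 'a gword = "('a \<times> bool) list"

definition gwords :: "'a set \<Rightarrow> 'a gword set" where
  "gwords X = lists (X \<times> UNIV)"

text \<open>A pair \<open>(r, s)\<close> in \<open>R\<close> is the defining relation \<open>r = s\<close>.\<close>

inductive_set pres_rel :: "'a set \<Rightarrow> ('a gword \<times> 'a gword) set \<Rightarrow> ('a gword \<times> 'a gword) set"
  for X :: "'a set" and R :: "('a gword \<times> 'a gword) set"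
where
  refl: "w \<in> gwords X \<Longrightarrow> (w, w) \<in> pres_rel X R"
| sym: "(v, w) \<in> pres_rel X R \<Longrightarrow> (w, v) \<in> pres_rel X R"
| trans: "(u, v) \<in> pres_rel X R \<Longrightarrow> (v, w) \<in> pres_rel X R \<Longrightarrow> (u, w) \<in> pres_rel X R"
| cancel: "u \<in> gwords X \<Longrightarrow> v \<in> gwords X \<Longrightarrow> x \<in> X \<Longrightarrow>
    (u @ [(x, b), (x, \<not> b)] @ v, u @ v) \<in> pres_rel X R"
| rel: "u \<in> gwords X \<Longrightarrow> v \<in> gwords X \<Longrightarrow> r \<in> gwords X \<Longrightarrow> s \<in> gwords X \<Longrightarrow> (r, s) \<in> R \<Longrightarrow>
    (u @ r @ v, u @ s @ v) \<in> pres_rel X R"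

definition presented_group :: "'a set \<Rightarrow> ('a gword \<times> 'a gword) set \<Rightarrow> 'a gword set monoid" where
  "presented_group X R =
    \<lparr>carrier = gwords X // pres_rel X R,
     mult = (\<lambda>A B. \<Union>u\<in>A. \<Union>v\<in>B. pres_rel X R `` {u @ v}),
     one = pres_rel X R `` {[]}\<rparr>"

definition pres_gen :: "'a set \<Rightarrow> ('a gword \<times> 'a gword) set \<Rightarrow> 'a \<Rightarrow> 'a gword set" where
  "pres_gen X R x = pres_rel X R `` {[(x, True)]}"

definition word_value :: "('g, 'm) monoid_scheme \<Rightarrow> ('a \<Rightarrow> 'g) \<Rightarrow> 'a gword \<Rightarrow> 'g" where
  "word_value G f w =
    foldr (\<lambda>(x, b) g. (if b then f x else inv\<^bsub>G\<^esub> (f x)) \<otimes>\<^bsub>G\<^esub> g) w \<one>\<^bsub>G\<^esub>"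

text \<open>The map out of a presented group determined by the images \<open>f\<close> of the generators; it is
  meaningful when the images satisfy the relations (lemma \<open>pres_lift\<close> below).\<close>

definition pres_lift :: "('g, 'm) monoid_scheme \<Rightarrow> ('a \<Rightarrow> 'g) \<Rightarrow> 'a gword set \<Rightarrow> 'g" where
  "pres_lift G f A = the_elem (word_value G f ` A)"

definition free_group :: "'a set \<Rightarrow> 'a gword set monoid" where
  "free_group X = presented_group X {}"

definition centralizer :: "('g, 'm) monoid_scheme \<Rightarrow> 'g \<Rightarrow> 'g set" where
  "centralizer G a = {g \<in> carrier G. g \<otimes>\<^bsub>G\<^esub> a = a \<otimes>\<^bsub>G\<^esub> g}"

lemma gwords_append [simp]: "u @ v \<in> gwords X \<longleftrightarrow> u \<in> gwords X \<and> v \<in> gwords X"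
  by (simp add: gwords_def)

lemma gwords_Nil [simp]: "[] \<in> gwords X"
  by (simp add: gwords_def)

lemma gwords_Cons [simp]: "(x, b) # w \<in> gwords X \<longleftrightarrow> x \<in> X \<and> w \<in> gwords X"
  by (auto simp: gwords_def)

lemma pres_rel_gwords: "(u, v) \<in> pres_rel X R \<Longrightarrow> u \<in> gwords X \<and> v \<in> gwords X"
  by (induction rule: pres_rel.induct) auto

lemma equiv_pres_rel: "equiv (gwords X) (pres_rel X R)"
  by (intro equivI refl_onI symI transI subsetI)
    (auto dest: pres_rel_gwords intro: pres_rel.refl pres_rel.sym pres_rel.trans)

lemma pres_rel_context:
  assumes "(u, v) \<in> pres_rel X R" "a \<in> gwords X" "b \<in> gwords X"
  shows "(a @ u @ b, a @ v @ b) \<in> pres_rel X R"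
  using assms
proof (induction rule: pres_rel.induct)
  case (cancel u v x c)
  then show ?case using pres_rel.cancel[of "a @ u" X "v @ b" x c R] by simp
next
  case (rel u v r s)
  then show ?case using pres_rel.rel[of "a @ u" X "v @ b" r s R] by simp
qed (auto intro: pres_rel.refl pres_rel.sym pres_rel.trans)

lemma pres_rel_append:
  assumes "(u, u') \<in> pres_rel X R" "(v, v') \<in> pres_rel X R"
  shows "(u @ v, u' @ v') \<in> pres_rel X R"
proof -
  have "(u @ v, u' @ v) \<in> pres_rel X R"
    using pres_rel_context[OF assms(1), of "[]" v] pres_rel_gwords[OF assms(2)] by simp
  moreover have "(u' @ v, u' @ v') \<in> pres_rel X R"
    using pres_rel_context[OF assms(2), of u' "[]"] pres_rel_gwords[OF assms(1)] by simp
  ultimately show ?thesis by (rule pres_rel.trans)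
qed

lemma pres_class_eq:
  "(u, v) \<in> pres_rel X R \<Longrightarrow> pres_rel X R `` {u} = pres_rel X R `` {v}"
  by (rule equiv_class_eq[OF equiv_pres_rel])

lemma presented_group_carrier_class:
  "w \<in> gwords X \<Longrightarrow> pres_rel X R `` {w} \<in> carrier (presented_group X R)"
  by (simp add: presented_group_def quotientI)

lemma presented_group_cases:
  assumes "A \<in> carrier (presented_group X R)"
  obtains w where "w \<in> gwords X" "A = pres_rel X R `` {w}"
  using assms by (auto simp: presented_group_def elim: quotientE)

lemma presented_group_mult_class:
  assumes "u \<in> gwords X" "v \<in> gwords X"
  shows "pres_rel X R `` {u} \<otimes>\<^bsub>presented_group X R\<^esub> pres_rel X R `` {v} = pres_rel X R `` {u @ v}"
proof -
  have eq: "pres_rel X R `` {u' @ v'} = pres_rel X R `` {u @ v}"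
    if "u' \<in> pres_rel X R `` {u}" "v' \<in> pres_rel X R `` {v}" for u' v'
    using pres_class_eq[OF pres_rel_append[of u u' X R v v']] that by simp
  have "u \<in> pres_rel X R `` {u}" "v \<in> pres_rel X R `` {v}"
    using assms by (auto intro: pres_rel.refl)
  then have ne: "pres_rel X R `` {u} \<noteq> {}" "pres_rel X R `` {v} \<noteq> {}"
    by blast+
  have "(\<Union>u'\<in>pres_rel X R `` {u}. \<Union>v'\<in>pres_rel X R `` {v}. pres_rel X R `` {u' @ v'})
      = (\<Union>u'\<in>pres_rel X R `` {u}. \<Union>v'\<in>pres_rel X R `` {v}. pres_rel X R `` {u @ v})"
    by (intro SUP_cong HOL.refl eq)
  also have "\<dots> = pres_rel X R `` {u @ v}"
    using ne by simp
  finally show ?thesis by (simp add: presented_group_def)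
qed

lemma pres_rel_inverse:
  "w \<in> gwords X \<Longrightarrow> (rev (map (\<lambda>(x, b). (x, \<not> b)) w) @ w, []) \<in> pres_rel X R
    \<and> rev (map (\<lambda>(x, b). (x, \<not> b)) w) \<in> gwords X"
proof (induction w)
  case Nil
  then show ?case by (auto intro: pres_rel.refl)
next
  case (Cons a w)
  obtain x b where a: "a = (x, b)" by fastforce
  define i where "i = rev (map (\<lambda>(x, b). (x, \<not> b)) w)"
  have w: "w \<in> gwords X" "x \<in> X" using Cons.prems a by auto
  with Cons.IH have i: "(i @ w, []) \<in> pres_rel X R" "i \<in> gwords X" by (auto simp: i_def)
  have "(i @ [(x, \<not> b), (x, \<not> \<not> b)] @ w, i @ w) \<in> pres_rel X R"
    using pres_rel.cancel[of i X w x "\<not> b" R] i w by blast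
  then have "(i @ [(x, \<not> b), (x, b)] @ w, []) \<in> pres_rel X R"
    using pres_rel.trans[OF _ i(1)] by simp
  then show ?case using w i by (simp add: a i_def [symmetric])
qed

lemma group_presented_group: "group (presented_group X R)"
proof (rule groupI)
  show "\<one>\<^bsub>presented_group X R\<^esub> \<in> carrier (presented_group X R)"
    by (simp add: presented_group_def quotientI)
next
  fix A B assume "A \<in> carrier (presented_group X R)" "B \<in> carrier (presented_group X R)"
  then show "A \<otimes>\<^bsub>presented_group X R\<^esub> B \<in> carrier (presented_group X R)"
    by (auto elim!: presented_group_cases
        simp: presented_group_mult_class presented_group_carrier_class)
next
  fix A B C assume "A \<in> carrier (presented_group X R)" "B \<in> carrier (presented_group X R)"
    "C \<in> carrier (presented_group X R)"
  then show "A \<otimes>\<^bsub>presented_group X R\<^esub> B \<otimes>\<^bsub>presented_group X R\<^esub> C =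
      A \<otimes>\<^bsub>presented_group X R\<^esub> (B \<otimes>\<^bsub>presented_group X R\<^esub> C)"
    by (auto elim!: presented_group_cases simp: presented_group_mult_class)
next
  have one: "\<one>\<^bsub>presented_group X R\<^esub> = pres_rel X R `` {[]}"
    by (simp add: presented_group_def)
  fix A assume "A \<in> carrier (presented_group X R)"
  then obtain w where w: "w \<in> gwords X" "A = pres_rel X R `` {w}"
    by (rule presented_group_cases)
  show "\<one>\<^bsub>presented_group X R\<^esub> \<otimes>\<^bsub>presented_group X R\<^esub> A = A"
    using w by (simp add: one presented_group_mult_class)
  show "\<exists>B\<in>carrier (presented_group X R). B \<otimes>\<^bsub>presented_group X R\<^esub> A = \<one>\<^bsub>presented_group X R\<^esub>"
    using w pres_rel_inverse[OF w(1), of R]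
      pres_class_eq[of "rev (map (\<lambda>(x, b). (x, \<not> b)) w) @ w" "[]" X R]
    by (intro bexI[of _ "pres_rel X R `` {rev (map (\<lambda>(x, b). (x, \<not> b)) w)}"])
      (simp_all add: one presented_group_mult_class presented_group_carrier_class)
qed

context group
begin

lemma word_value_Nil [simp]: "word_value G f [] = \<one>"
  by (simp add: word_value_def)

lemma word_value_Cons [simp]:
  "word_value G f ((x, b) # w) = (if b then f x else inv (f x)) \<otimes> word_value G f w"
  by (simp add: word_value_def)

lemma word_value_closed [simp]:
  "f \<in> X \<rightarrow> carrier G \<Longrightarrow> w \<in> gwords X \<Longrightarrow> word_value G f w \<in> carrier G"
  by (induction w) (auto simp: Pi_iff)

lemma word_value_append:
  "f \<in> X \<rightarrow> carrier G \<Longrightarrow> u \<in> gwords X \<Longrightarrow> v \<in> gwords X \<Longrightarrow>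
    word_value G f (u @ v) = word_value G f u \<otimes> word_value G f v"
  by (induction u) (auto simp: m_assoc Pi_iff)

lemma word_value_pres_rel:
  assumes f: "f \<in> X \<rightarrow> carrier G"
    and R: "\<And>r s. (r, s) \<in> R \<Longrightarrow> r \<in> gwords X \<Longrightarrow> s \<in> gwords X \<Longrightarrow> word_value G f r = word_value G f s"
    and uv: "(u, v) \<in> pres_rel X R"
  shows "word_value G f u = word_value G f v"
  using uv
proof (induction rule: pres_rel.induct)
  case (cancel u v x b)
  have fx: "f x \<in> carrier G" using f cancel by auto
  have v: "word_value G f v \<in> carrier G" using f cancel by simp
  have "f x \<otimes> (inv f x \<otimes> word_value G f v) = word_value G f v"
    "inv f x \<otimes> (f x \<otimes> word_value G f v) = word_value G f v"
    using fx v by (simp_all flip: m_assoc)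
  then show ?case using f cancel by (simp add: word_value_append)
next
  case (rel u v r s)
  then show ?case using f R by (simp add: word_value_append)
qed auto

lemma pres_lift_class:
  assumes "f \<in> X \<rightarrow> carrier G"
    and "\<And>r s. (r, s) \<in> R \<Longrightarrow> r \<in> gwords X \<Longrightarrow> s \<in> gwords X \<Longrightarrow> word_value G f r = word_value G f s"
    and w: "w \<in> gwords X"
  shows "pres_lift G f (pres_rel X R `` {w}) = word_value G f w"
proof -
  have "w \<in> pres_rel X R `` {w}" using w by (auto intro: pres_rel.refl)
  moreover have "word_value G f v = word_value G f w" if "v \<in> pres_rel X R `` {w}" for v
    using word_value_pres_rel[OF assms(1,2), of R w v] that by auto
  ultimately have "word_value G f ` (pres_rel X R `` {w}) = {word_value G f w}"
    by blast
  then show ?thesis by (simp add: pres_lift_def)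
qed

lemma pres_lift:
  assumes f: "f \<in> X \<rightarrow> carrier G"
    and R: "\<And>r s. (r, s) \<in> R \<Longrightarrow> r \<in> gwords X \<Longrightarrow> s \<in> gwords X \<Longrightarrow> word_value G f r = word_value G f s"
  shows "pres_lift G f \<in> hom (presented_group X R) G"
    and "x \<in> X \<Longrightarrow> pres_lift G f (pres_gen X R x) = f x"
proof -
  note cl = pres_lift_class[OF f R, simplified]
  show "pres_lift G f \<in> hom (presented_group X R) G"
    by (rule homI)
      (auto elim!: presented_group_cases
        simp: presented_group_mult_class cl word_value_append[OF f] word_value_closed[OF f])
  show "pres_lift G f (pres_gen X R x) = f x" if "x \<in> X"
    using that funcset_mem[OF f that] by (simp add: pres_gen_def cl)
qed

end


section \<open>Braid groups\<close>

definition braid_rels :: "nat \<Rightarrow> (nat gword \<times> nat gword) set" where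
  "braid_rels n =
    {([(i, True), (j, True)], [(j, True), (i, True)]) | i j.
        i \<in> {1..<n} \<and> j \<in> {1..<n} \<and> i + 2 \<le> j}
    \<union> {([(i, True), (i + 1, True), (i, True)], [(i + 1, True), (i, True), (i + 1, True)]) | i.
        i \<in> {1..<n} \<and> i + 1 \<in> {1..<n}}"

definition braid_group :: "nat \<Rightarrow> nat gword set monoid" where
  "braid_group n = presented_group {1..<n} (braid_rels n)"

abbreviation B4 :: "nat gword set monoid" where
  "B4 \<equiv> braid_group 4"

text \<open>The standard generators of the braid group on four strands.\<close>

definition braid_sigma :: "nat \<Rightarrow> nat gword set" where
  "braid_sigma = pres_gen {1..<4} (braid_rels 4)"

definition braid_b1 :: "nat gword set" where
  "braid_b1 = braid_sigma 1 \<otimes>\<^bsub>B4\<^esub> inv\<^bsub>B4\<^esub> braid_sigma 3"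

definition braid_b2 :: "nat gword set" where
  "braid_b2 = braid_sigma 1 \<otimes>\<^bsub>B4\<^esub> braid_sigma 2 \<otimes>\<^bsub>B4\<^esub> braid_sigma 3 \<otimes>\<^bsub>B4\<^esub>
    inv\<^bsub>B4\<^esub> braid_sigma 1 \<otimes>\<^bsub>B4\<^esub> inv\<^bsub>B4\<^esub> braid_sigma 2 \<otimes>\<^bsub>B4\<^esub> inv\<^bsub>B4\<^esub> braid_sigma 1"


section \<open>Laurent polynomials and matrices over them\<close>

text \<open>Finitely supported functions on the integers with the convolution product; the exponent is
  the argument.\<close>

type_synonym 'a laurent = "int \<Rightarrow>\<^sub>0 'a"

definition tvar :: "'a::comm_ring_1 laurent" where
  "tvar = Poly_Mapping.single 1 1"

definition GL :: "('a::comm_ring_1 ^ 'n ^ 'n) monoid" where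
  "GL = \<lparr>carrier = {A. invertible A}, mult = (**), one = mat 1\<rparr>"

text \<open>Coefficientwise reduction. It is used with \<open>'b = 'p mod_ring\<close> for a type \<open>'p\<close> of class
  \<open>prime_card\<close>, i.e. with \<open>CARD('p) = p\<close> an arbitrary prime; \<open>'p mod_ring\<close> is then the field of
  \<open>p\<close> elements.\<close>

definition reduce :: "int laurent \<Rightarrow> 'b::comm_ring_1 laurent" where
  "reduce = Poly_Mapping.map of_int"

definition reduce_mat :: "int laurent ^ 'n ^ 'n \<Rightarrow> 'b::comm_ring_1 laurent ^ 'n ^ 'n" where
  "reduce_mat = map_matrix reduce"

lemma group_GL: "group GL"
proof (rule groupI)
  fix A :: "'a ^ 'n ^ 'n" assume "A \<in> carrier GL"
  then show "\<exists>B\<in>carrier GL. B \<otimes>\<^bsub>GL\<^esub> A = \<one>\<^bsub>GL\<^esub>"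
    by (auto simp: GL_def invertible_def)
qed (auto simp: GL_def matrix_mul_assoc invertible_mult, auto simp: invertible_def)

lemma lookup_reduce: "Poly_Mapping.lookup (reduce p) k = of_int (Poly_Mapping.lookup p k)"
  by (simp add: reduce_def Poly_Mapping.map.rep_eq when_def)

lemma reduce_add: "reduce (p + q) = reduce p + reduce q"
  by (rule poly_mapping_eqI) (simp add: lookup_reduce lookup_add)

lemma reduce_single: "reduce (Poly_Mapping.single k a) = Poly_Mapping.single k (of_int a)"
  by (rule poly_mapping_eqI) (simp add: lookup_reduce lookup_single when_def)

lemma reduce_0: "reduce 0 = 0"
  by (rule poly_mapping_eqI) (simp add: lookup_reduce)

lemma reduce_1: "reduce 1 = 1"
  using reduce_single[of 0 1] by (simp add: single_one)

lemma laurent_induct: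
  fixes p :: "'a::comm_ring_1 laurent"
  assumes "P 0" "\<And>k a. P (Poly_Mapping.single k a)" "\<And>p q. P p \<Longrightarrow> P q \<Longrightarrow> P (p + q)"
  shows "P p"
proof (induction p rule: update_induct)
  case (update p k a)
  have "Poly_Mapping.update k a p = Poly_Mapping.single k a + p"
    using update.hyps
    by (intro poly_mapping_eqI) (auto simp: lookup_update lookup_add lookup_single in_keys_iff when_def)
  then show ?case using assms update.IH by simp
qed (rule assms)

lemma reduce_mult: "reduce (p * q) = reduce p * reduce q"
proof (induction p rule: laurent_induct)
  case (2 k a)
  show ?case
    by (induction q rule: laurent_induct)
      (simp_all add: mult_single reduce_single reduce_add reduce_0 distrib_left)
qed (simp_all add: reduce_0 reduce_add distrib_right)

lemma reduce_sum: "reduce (sum f A) = (\<Sum>x\<in>A. reduce (f x))"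
  by (induction A rule: infinite_finite_induct) (simp_all add: reduce_0 reduce_add)

lemma reduce_mat_mult: "reduce_mat (A ** B) = reduce_mat A ** reduce_mat B"
  by (simp add: reduce_mat_def vec_eq_iff matrix_matrix_mult_def reduce_sum reduce_mult)

lemma reduce_mat_1: "reduce_mat (mat 1) = mat 1"
  by (simp add: reduce_mat_def vec_eq_iff mat_def reduce_0 reduce_1)

lemma reduce_mat_hom: "reduce_mat \<in> hom GL GL"
proof (rule homI)
  fix A :: "int laurent ^ 'n ^ 'n"
  assume "A \<in> carrier GL"
  then show "(reduce_mat A :: 'b laurent ^ 'n ^ 'n) \<in> carrier GL"
    unfolding GL_def invertible_def by simp (metis reduce_mat_1 reduce_mat_mult)
qed (simp add: GL_def reduce_mat_mult)


section \<open>The reduced Burau representation of the braid group on four strands\<close>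

definition burau_gen :: "nat \<Rightarrow> int laurent ^ 3 ^ 3" where
  "burau_gen i =
    (if i = 1 then
       vector [vector [- tvar, 1, 0],
               vector [0, 1, 0],
               vector [0, 0, 1]]
     else if i = 2 then
       vector [vector [1, 0, 0],
               vector [tvar, - tvar, 1],
               vector [0, 0, 1]]
     else
       vector [vector [1, 0, 0],
               vector [0, 1, 0],
               vector [0, tvar, - tvar]])"

definition burau4 :: "nat gword set \<Rightarrow> int laurent ^ 3 ^ 3" where
  "burau4 = pres_lift GL burau_gen"

definition burau_S :: "int laurent ^ 3 ^ 3" where
  "burau_S = burau4 braid_b1"

definition burau_T :: "int laurent ^ 3 ^ 3" where
  "burau_T = burau4 braid_b2"

lemma burau_gen_invertible: "burau_gen i \<in> carrier GL"
proof -
  define s :: "int laurent" where "s = Poly_Mapping.single (-1) 1"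
  have ts: "tvar * s = 1" "s * tvar = 1"
    by (simp_all add: tvar_def s_def mult_single single_one)
  define J :: "int laurent ^ 3 ^ 3" where
    "J = (if i = 1 then vector [vector [- s, s, 0], vector [0, 1, 0], vector [0, 0, 1]]
      else if i = 2 then vector [vector [1, 0, 0], vector [1, - s, s], vector [0, 0, 1]]
      else vector [vector [1, 0, 0], vector [0, 1, 0], vector [0, 1, - s]])"
  have "burau_gen i ** J = mat 1" "J ** burau_gen i = mat 1"
    by (simp_all add: J_def burau_gen_def vec_eq_iff forall_3 matrix_matrix_mult_def sum_3
        mat_def vector_3 ts)
  then show ?thesis by (auto simp: GL_def invertible_def)
qed

lemma burau_gen_rels:
  assumes "(r, s) \<in> braid_rels 4"
  shows "word_value GL burau_gen r = word_value GL burau_gen s"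
proof -
  have 13: "burau_gen 1 ** burau_gen 3 = burau_gen 3 ** burau_gen 1"
    and 12: "burau_gen 1 ** (burau_gen 2 ** burau_gen 1) = burau_gen 2 ** (burau_gen 1 ** burau_gen 2)"
    and 23: "burau_gen 2 ** (burau_gen 3 ** burau_gen 2) = burau_gen 3 ** (burau_gen 2 ** burau_gen 3)"
    by (simp_all add: burau_gen_def vec_eq_iff forall_3 matrix_matrix_mult_def sum_3
        vector_3 algebra_simps)
  have wv: "word_value GL f [] = mat 1"
    "word_value GL f ((i, True) # w) = f i ** word_value GL f w"
    for f :: "nat \<Rightarrow> int laurent ^ 3 ^ 3" and i w
    by (simp_all add: word_value_def GL_def)
  from assms consider
      i j where "r = [(i, True), (j, True)]" "s = [(j, True), (i, True)]"
        "i \<in> {1..<4}" "j \<in> {1..<4}" "i + 2 \<le> j"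
    | i where "r = [(i, True), (i + 1, True), (i, True)]"
        "s = [(i + 1, True), (i, True), (i + 1, True)]" "i \<in> {1..<4}" "i + 1 \<in> {1..<4}"
    unfolding braid_rels_def by blast
  then show ?thesis
  proof cases
    case (1 i j)
    then have "i = 1" "j = 3" by auto
    then show ?thesis using 1 13 by (simp add: wv)
  next
    case (2 i)
    then have "i = 1 \<and> i + 1 = 2 \<or> i = 2 \<and> i + 1 = 3" by auto
    then show ?thesis using 2(1,2) 12 23 by (elim disjE conjE) (simp_all only: wv matrix_mul_rid)
  qed
qed

lemma group_braid_group: "group (braid_group n)"
  by (simp add: braid_group_def group_presented_group)

lemma burau4_hom: "burau4 \<in> hom B4 GL"
  unfolding burau4_def braid_group_def
  by (rule group.pres_lift(1)[OF group_GL]) (auto simp: burau_gen_invertible burau_gen_rels)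

lemma burau4_braid_sigma: "i \<in> {1..<4} \<Longrightarrow> burau4 (braid_sigma i) = burau_gen i"
  unfolding burau4_def braid_sigma_def
  by (rule group.pres_lift(2)[OF group_GL]) (auto simp: burau_gen_invertible burau_gen_rels)

end

theory Submission
  imports Defs "HOL-Algebra.Elementary_Groups" "HOL-Algebra.Bij"
begin

text \<open>
  Write \<open>\<sigma>\<^sub>1, \<sigma>\<^sub>2, \<sigma>\<^sub>3\<close> for the standard generators, \<open>N\<close> for the subgroup generated by \<open>b\<^sub>1\<close> and
  \<open>b\<^sub>2\<close>, \<open>H\<close> for the one generated by \<open>\<sigma>\<^sub>2\<close> and \<open>\<sigma>\<^sub>3\<close>, and put \<open>c = b\<^sub>2 b\<^sub>1 b\<^sub>2\<inverse>\<close>,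
  \<open>\<Delta> = \<sigma>\<^sub>2 \<sigma>\<^sub>3 \<sigma>\<^sub>2\<close> and \<open>\<xi> = b\<^sub>1 \<Delta>\<^sup>2\<close>. The subgroup \<open>N\<close> is normal and \<open>B\<^sub>4 = N H\<close>; conjugation
  by \<open>\<sigma>\<^sub>3\<close> fixes \<open>b\<^sub>1\<close> and sends \<open>b\<^sub>2\<close> to \<open>b\<^sub>2 b\<^sub>1\<close>.

  The first half of the proof shows that every element of the centralizer of \<open>\<sigma>\<^sub>3\<close> has the form
  \<open>f k\<close> with \<open>f\<close> in \<open>\<langle>b\<^sub>1, c\<rangle>\<close> and \<open>k\<close> in the abelian group \<open>\<langle>\<sigma>\<^sub>3, \<xi>\<rangle>\<close>
  (\<open>centralizer_factorization\<close>). The tool is an action of \<open>B\<^sub>4\<close> on triples \<open>(r, a, b)\<close> of elements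
  of an arbitrary group \<open>G\<close>. A braid in \<open>N\<close> that is the word \<open>w(b\<^sub>1, b\<^sub>2)\<close> only replaces \<open>r\<close> by
  \<open>w(a, b) r\<close>, while \<open>H\<close> acts on the pair \<open>(a, b)\<close> by substitutions. Two groups \<open>G\<close> are used.
  For \<open>G = \<int>\<close> the action on \<open>(a, b)\<close> is the linear action of \<open>SL\<^sub>2(\<int>)\<close>; a positivity argument on
  a normal form of the elements of \<open>H\<close> shows that those which preserve the line fixed by
  \<open>\<sigma>\<^sub>3\<close> lie in \<open>\<langle>\<sigma>\<^sub>3, \<Delta>\<^sup>2\<rangle>\<close> (\<open>stabilizer_in_W\<close>). For \<open>G = GL\<^sub>2(\<int>)\<close> and matrices \<open>a\<close>, \<open>b\<close>
  that play ping-pong, a braid \<open>w(b\<^sub>1, b\<^sub>2)\<close> that commutes with \<open>\<sigma>\<^sub>3\<close> satisfies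
  \<open>w(a, b) = w(a, b a)\<close>, and this forces \<open>w\<close> into \<open>\<langle>b\<^sub>1, c\<rangle>\<close> (\<open>twisted_fixed_words\<close>).

  The second half studies the Burau matrices of these elements. They all preserve the line spanned
  by the third basis vector, so they act on the quotient plane with coordinates \<open>v\<^sub>1, v\<^sub>2\<close>. There
  \<open>b\<^sub>1\<close> and \<open>c\<close> play ping-pong with respect to the \<open>t\<close>-adic valuation of \<open>v\<^sub>1 / v\<^sub>2\<close>, and \<open>\<xi>\<close>
  and \<open>\<sigma>\<^sub>3\<close> preserve the region where this valuation is \<open>1\<close>, from which every nontrivial reduced
  word in \<open>b\<^sub>1\<close> and \<open>c\<close> moves all points away. Hence \<open>f k\<close> can act trivially only if \<open>f\<close> is
  the trivial word, and \<open>k\<close> is then recovered from the eigenvalues of \<open>\<xi>\<^sup>2\<close>, which is the scalar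
  \<open>t\<^sup>4\<close>, and of \<open>\<sigma>\<^sub>3\<^sup>2\<close>. All coefficients that decide a valuation are \<open>1\<close> or \<open>- 1\<close> times a
  given nonzero one, so the argument works over every commutative ring with \<open>0 \<noteq> 1\<close>; in
  particular it is uniform in the prime. The ping-pong also gives the freeness of the two matrices
  in the last claim, since they are the images of \<open>b\<^sub>1\<close> and \<open>c\<close>.
\<close>

section \<open>Reduced words and ping-pong\<close>

definition reduced_word :: "'a gword \<Rightarrow> bool" where
  "reduced_word = successively (\<lambda>p q. q \<noteq> (fst p, \<not> snd p))"

lemma reduced_word_Nil [simp]: "reduced_word []"
  by (simp add: reduced_word_def)

lemma reduced_word_Cons:
  "reduced_word (p # w) \<longleftrightarrow> reduced_word w \<and> (w \<noteq> [] \<longrightarrow> hd w \<noteq> (fst p, \<not> snd p))"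
  by (cases w) (auto simp: reduced_word_def)

lemma exists_reduced_word:
  assumes "w \<in> gwords X"
  shows "\<exists>v. v \<in> gwords X \<and> reduced_word v \<and> (w, v) \<in> pres_rel X R"
  using assms
proof (induction w)
  case Nil
  show ?case by (rule exI[of _ "[]"]) (simp add: pres_rel.refl)
next
  case (Cons p w)
  obtain x b where p: "p = (x, b)" by fastforce
  from Cons p obtain v where v: "v \<in> gwords X" "reduced_word v" "(w, v) \<in> pres_rel X R" and x: "x \<in> X"
    by auto
  have pv: "(p # w, p # v) \<in> pres_rel X R"
    using pres_rel_context[OF v(3), of "[p]" "[]"] x p by simp
  show ?case
  proof (cases "v \<noteq> [] \<and> hd v = (x, \<not> b)")
    case True
    then obtain v' where v': "v = (x, \<not> b) # v'" by (cases v) auto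
    have "(p # v, v') \<in> pres_rel X R"
      using pres_rel.cancel[of "[]" X v' x b R] v v' x p by simp
    with pv have "(p # w, v') \<in> pres_rel X R" by (rule pres_rel.trans)
    with v v' show ?thesis by (auto simp: reduced_word_Cons)
  next
    case False
    with v p x pv show ?thesis by (intro exI[of _ "p # v"]) (auto simp: reduced_word_Cons)
  qed
qed

lemma GL_simps [simp]:
  "carrier GL = {A. invertible A}" "A \<otimes>\<^bsub>GL\<^esub> B = A ** B" "\<one>\<^bsub>GL\<^esub> = mat 1"
  by (simp_all add: GL_def)

lemma inv_GL_eqI:
  fixes A B :: "'a::comm_ring_1 ^ 'n ^ 'n"
  assumes "A ** B = mat 1" "B ** A = mat 1"
  shows "inv\<^bsub>GL\<^esub> A = B"
  by (rule group.inv_equality[OF group_GL]) (use assms in \<open>auto simp: invertible_def\<close>)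

text \<open>
  Every letter maps the start vectors, and every region except that of its inverse letter, into its
  own region. In a reduced word no letter is applied right after its inverse, so by induction the
  region that contains the current vector is always that of the letter applied last.
\<close>

lemma ping_pong:
  fixes f :: "'i \<Rightarrow> 'a::comm_ring_1 ^ 'n ^ 'n"
  assumes f: "f \<in> X \<rightarrow> carrier GL"
    and base: "\<And>x b v. x \<in> X \<Longrightarrow> v \<in> V \<Longrightarrow>
      (if b then f x else inv\<^bsub>GL\<^esub> (f x)) *v v \<in> P (x, b)"
    and step: "\<And>x b q v. x \<in> X \<Longrightarrow> fst q \<in> X \<Longrightarrow> q \<noteq> (x, \<not> b) \<Longrightarrow> v \<in> P q \<Longrightarrow>
      (if b then f x else inv\<^bsub>GL\<^esub> (f x)) *v v \<in> P (x, b)"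
    and w: "w \<in> gwords X" "reduced_word w" "w \<noteq> []" and v: "v \<in> V"
  shows "word_value GL f w *v v \<in> P (hd w)"
  using w
proof (induction w)
  case (Cons p w)
  obtain x b where p: "p = (x, b)" by fastforce
  show ?case
  proof (cases w)
    case Nil
    then show ?thesis
      using base[of x v b] Cons.prems v p by (simp add: group.word_value_Cons[OF group_GL]
          group.word_value_Nil[OF group_GL])
  next
    case (Cons q w')
    have "word_value GL f w *v v \<in> P q"
      using Cons.IH Cons.prems Cons by (simp add: reduced_word_Cons p)
    then show ?thesis
      using step[of x q b "word_value GL f w *v v"] Cons.prems Cons p
      by (cases q) (simp add: group.word_value_Cons[OF group_GL] matrix_vector_mul_assoc reduced_word_Cons)
  qed
qed simp

text \<open>
  The start vectors form a set that need not be a single point. This matters because the vector to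
  which a word is applied will first have been moved, within this set, by further matrices.
\<close>

lemma ping_pong_free:
  fixes f :: "'i \<Rightarrow> 'a::comm_ring_1 ^ 'n ^ 'n"
  assumes "f \<in> X \<rightarrow> carrier GL"
    and "\<And>x b v. x \<in> X \<Longrightarrow> v \<in> V \<Longrightarrow>
      (if b then f x else inv\<^bsub>GL\<^esub> (f x)) *v v \<in> P (x, b)"
    and "\<And>x b q v. x \<in> X \<Longrightarrow> fst q \<in> X \<Longrightarrow> q \<noteq> (x, \<not> b) \<Longrightarrow> v \<in> P q \<Longrightarrow>
      (if b then f x else inv\<^bsub>GL\<^esub> (f x)) *v v \<in> P (x, b)"
    and disj: "\<And>q. fst q \<in> X \<Longrightarrow> P q \<inter> V = {}"
    and w: "w \<in> gwords X" and v: "v \<in> V" and "word_value GL f w *v v \<in> V"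
  shows "(w, []) \<in> pres_rel X {}"
proof -
  obtain u where u: "u \<in> gwords X" "reduced_word u" "(w, u) \<in> pres_rel X {}"
    using exists_reduced_word[OF w] by blast
  have "word_value GL f w = word_value GL f u"
    by (rule group.word_value_pres_rel[OF group_GL assms(1) _ u(3)]) auto
  then have uv: "word_value GL f u *v v \<in> V" using assms(7) by simp
  have "u = []"
  proof (rule ccontr)
    assume "u \<noteq> []"
    then have "word_value GL f u *v v \<in> P (hd u)"
      by (intro ping_pong[where X = X and V = V] assms u) 
    moreover have "fst (hd u) \<in> X" using u \<open>u \<noteq> []\<close> by (cases u) auto
    ultimately show False using uv disj by blast
  qed
  then show ?thesis using u by simp
qed

section \<open>Generated subgroups\<close>

context group
begin

lemma inv_cancel_left:
  assumes "a \<in> carrier G" "w \<in> carrier G"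
  shows "inv a \<otimes> (a \<otimes> w) = w" "a \<otimes> (inv a \<otimes> w) = w"
  using assms by (simp_all flip: m_assoc)

text \<open>
  A set of normal forms exhausts a generated group once it is stable under left multiplication by
  the generators and their inverses; all factorizations below are proved in this way.
\<close>

lemma generate_subset_of_left_closed:
  assumes "K \<subseteq> carrier G" "Y \<subseteq> carrier G" "\<one> \<in> Y"
    and "\<And>k v. k \<in> K \<Longrightarrow> v \<in> Y \<Longrightarrow> k \<otimes> v \<in> Y"
    and "\<And>k v. k \<in> K \<Longrightarrow> v \<in> Y \<Longrightarrow> inv k \<otimes> v \<in> Y"
  shows "generate G K \<subseteq> Y"
proof
  fix g assume g: "g \<in> generate G K"
  have "\<forall>v\<in>Y. g \<otimes> v \<in> Y"
    using g
  proof (induction rule: generate.induct)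
    case (eng h1 h2)
    then have "h1 \<in> carrier G" "h2 \<in> carrier G"
      using generate_in_carrier[OF assms(1)] by auto
    with eng assms(2) show ?case by (auto simp: m_assoc subset_iff)
  qed (use assms in auto)
  then show "g \<in> Y"
    using assms(3) g generate_in_carrier[OF assms(1) g] by force
qed

lemma conj_generate:
  assumes K: "K \<subseteq> carrier G" and h: "h \<in> carrier G"
    and conj: "\<And>k. k \<in> K \<Longrightarrow> h \<otimes> k \<otimes> inv h \<in> generate G K"
    and g: "g \<in> generate G K"
  shows "h \<otimes> g \<otimes> inv h \<in> generate G K"
  using g
proof (induction rule: generate.induct)
  case one
  show ?case using h by (simp add: generate.one)
next
  case (incl k)
  then show ?case by (rule conj)
next
  case (inv k)
  then have "inv (h \<otimes> k \<otimes> inv h) \<in> generate G K"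
    by (intro generate_m_inv_closed K conj)
  then show ?case using inv K h by (auto simp: inv_mult_group m_assoc subset_iff)
next
  case (eng a b)
  have "a \<in> carrier G" "b \<in> carrier G"
    using eng generate_in_carrier[OF K] by auto
  then have "h \<otimes> (a \<otimes> b) \<otimes> inv h = (h \<otimes> a \<otimes> inv h) \<otimes> (h \<otimes> b \<otimes> inv h)"
    using h by (simp add: m_assoc inv_cancel_left)
  with eng.IH show ?case by (metis generate.eng)
qed

lemma intertwine_inv:
  assumes "a \<in> carrier G" "b \<in> carrier G" "d \<in> carrier G" "a \<otimes> b = d \<otimes> a"
  shows "a \<otimes> inv b = inv d \<otimes> a"
proof -
  have "inv d \<otimes> (d \<otimes> a) \<otimes> inv b = inv d \<otimes> (a \<otimes> b) \<otimes> inv b" by (simp add: assms(4))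
  then show ?thesis using assms(1-3) by (simp add: inv_cancel_left m_assoc)
qed

lemma commutes_inv:
  assumes "a \<in> carrier G" "b \<in> carrier G" "a \<otimes> b = b \<otimes> a"
  shows "inv a \<otimes> b = b \<otimes> inv a"
  using intertwine_inv[of b a a] assms by simp

lemma commutes_generate:
  assumes K: "K \<subseteq> carrier G" and a: "a \<in> carrier G"
    and comm: "\<And>k. k \<in> K \<Longrightarrow> k \<otimes> a = a \<otimes> k" and g: "g \<in> generate G K"
  shows "g \<otimes> a = a \<otimes> g"
  using g
proof (induction rule: generate.induct)
  case (eng g h)
  have "g \<in> carrier G" "h \<in> carrier G"
    using eng generate_in_carrier[OF K] by auto
  then show ?case using eng a by (metis m_assoc)
qed (use K a comm commutes_inv in auto)

end

section \<open>Factorizations from the braid relations\<close>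

text \<open>
  Only the relations matter in this section, so it is set in an arbitrary group with three elements
  that satisfy them.
\<close>

locale braid_triple = group +
  fixes x y z
  assumes x [simp]: "x \<in> carrier G" and y [simp]: "y \<in> carrier G" and z [simp]: "z \<in> carrier G"
    and xz: "x \<otimes> z = z \<otimes> x"
    and xyx: "x \<otimes> y \<otimes> x = y \<otimes> x \<otimes> y"
    and yzy: "y \<otimes> z \<otimes> y = z \<otimes> y \<otimes> z"
begin

definition "b1 = x \<otimes> inv z"
definition "b2 = x \<otimes> y \<otimes> z \<otimes> inv x \<otimes> inv y \<otimes> inv x"
definition "c = b2 \<otimes> b1 \<otimes> inv b2"
definition "\<Delta> = y \<otimes> z \<otimes> y"
definition "\<xi> = b1 \<otimes> (\<Delta> \<otimes> \<Delta>)"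

lemma closed [simp]:
  "b1 \<in> carrier G" "b2 \<in> carrier G" "c \<in> carrier G" "\<Delta> \<in> carrier G" "\<xi> \<in> carrier G"
  by (simp_all add: b1_def b2_def c_def \<Delta>_def \<xi>_def)

text \<open>
  The braid relations, oriented so that rewriting decreases a word lexicographically
  (\<open>x < y < z\<close>) and therefore terminates.
\<close>

lemma braid_assoc:
  "w \<in> carrier G \<Longrightarrow> z \<otimes> (x \<otimes> w) = x \<otimes> (z \<otimes> w)"
  "w \<in> carrier G \<Longrightarrow> y \<otimes> (x \<otimes> (y \<otimes> w)) = x \<otimes> (y \<otimes> (x \<otimes> w))"
  "w \<in> carrier G \<Longrightarrow> z \<otimes> (y \<otimes> (z \<otimes> w)) = y \<otimes> (z \<otimes> (y \<otimes> w))"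
  using xz xyx yzy by (simp_all flip: m_assoc)

lemma braid_assoc':
  "z \<otimes> x = x \<otimes> z" "y \<otimes> (x \<otimes> y) = x \<otimes> (y \<otimes> x)" "z \<otimes> (y \<otimes> z) = y \<otimes> (z \<otimes> y)"
  using xz xyx yzy by (simp_all flip: m_assoc)

lemmas cancel_simps = m_assoc inv_cancel_left

lemma b1_z: "b1 \<otimes> z = x"
  by (simp add: b1_def cancel_simps)

lemma z_b1: "z \<otimes> b1 = b1 \<otimes> z"
proof -
  have "z \<otimes> b1 = z \<otimes> x \<otimes> inv z" by (simp add: b1_def m_assoc)
  also have "\<dots> = x" by (simp add: cancel_simps braid_assoc)
  finally show ?thesis by (simp add: b1_z)
qed

text \<open>
  The element \<open>b2\<close> is the conjugate of \<open>z \<otimes> inv x\<close> by \<open>p = x \<otimes> y\<close>, and conjugation by \<open>p\<close>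
  turns \<open>x\<close> into \<open>y\<close>, while \<open>x\<close> commutes with \<open>z \<otimes> inv x\<close>.
\<close>

lemma y_b2: "y \<otimes> b2 = b2 \<otimes> y"
proof -
  define p u where "p = x \<otimes> y" and "u = z \<otimes> inv x"
  have pu [simp]: "p \<in> carrier G" "u \<in> carrier G" by (simp_all add: p_def u_def)
  have b2: "b2 = p \<otimes> u \<otimes> inv p"
    by (simp add: b2_def p_def u_def inv_mult_group m_assoc)
  have yp: "y \<otimes> p = p \<otimes> x"
    by (simp add: p_def cancel_simps braid_assoc')
  have xu: "x \<otimes> u = u \<otimes> x"
    using xz by (simp add: u_def cancel_simps flip: braid_assoc(1))
  have py: "inv p \<otimes> y = x \<otimes> inv p"
    using yp by (metis inv_closed inv_solve_left' inv_solve_right m_assoc m_closed pu(1) x y)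
  have "y \<otimes> b2 = (y \<otimes> p) \<otimes> u \<otimes> inv p" by (simp add: b2 m_assoc)
  also have "\<dots> = p \<otimes> (x \<otimes> u) \<otimes> inv p" unfolding yp by (simp add: m_assoc)
  also have "\<dots> = p \<otimes> u \<otimes> (x \<otimes> inv p)" unfolding xu by (simp add: m_assoc)
  also have "\<dots> = b2 \<otimes> y" by (simp add: b2 m_assoc flip: py)
  finally show ?thesis .
qed

lemma z_b2: "z \<otimes> b2 = b2 \<otimes> b1 \<otimes> z"
proof -
  \<comment> \<open>Multiplying by \<open>?r\<close> on the right removes all inverse letters.\<close>
  let ?r = "x \<otimes> (y \<otimes> x)"
  have "z \<otimes> b2 \<otimes> ?r = x \<otimes> (y \<otimes> (z \<otimes> y))"
    by (simp add: b2_def cancel_simps braid_assoc braid_assoc')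
  moreover have "b2 \<otimes> x \<otimes> ?r = x \<otimes> (y \<otimes> (z \<otimes> y))"
  proof -
    have "inv y \<otimes> (x \<otimes> (y \<otimes> x)) = x \<otimes> y"
      by (simp add: cancel_simps flip: braid_assoc')
    then show ?thesis by (simp add: b2_def cancel_simps)
  qed
  ultimately have "z \<otimes> b2 \<otimes> ?r = b2 \<otimes> x \<otimes> ?r" by simp
  then have "z \<otimes> b2 = b2 \<otimes> x" by (subst (asm) right_cancel) simp_all
  then show ?thesis by (simp add: m_assoc b1_z)
qed

lemma y_b2_b1: "y \<otimes> (b2 \<otimes> b1) = b1 \<otimes> y"
proof -
  let ?r = "z \<otimes> (y \<otimes> x)"
  have "y \<otimes> (b2 \<otimes> b1) \<otimes> ?r = y \<otimes> (x \<otimes> (y \<otimes> z))"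
    by (simp add: b2_def b1_def cancel_simps)
  moreover have "b1 \<otimes> y \<otimes> ?r = x \<otimes> (inv z \<otimes> (y \<otimes> (z \<otimes> (y \<otimes> x))))"
    by (simp add: b1_def cancel_simps)
  moreover have "y \<otimes> (z \<otimes> (y \<otimes> x)) = z \<otimes> (y \<otimes> (z \<otimes> x))"
    by (simp add: braid_assoc)
  ultimately have "y \<otimes> (b2 \<otimes> b1) \<otimes> ?r = b1 \<otimes> y \<otimes> ?r"
    by (simp add: inv_cancel_left braid_assoc braid_assoc')
  then show ?thesis by (subst (asm) right_cancel) simp_all
qed

abbreviation "N \<equiv> generate G {b1, b2}"
abbreviation "W \<equiv> generate G {z, \<Delta> \<otimes> \<Delta>}"

lemma N_closed: "n \<in> N \<Longrightarrow> n \<in> carrier G"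
  using generate_in_carrier[of "{b1, b2}"] by simp

lemma conj_gens:
  "y \<otimes> b1 \<otimes> inv y = inv b2 \<otimes> b1" "y \<otimes> b2 \<otimes> inv y = b2"
  "inv y \<otimes> b1 \<otimes> inv (inv y) = b2 \<otimes> b1" "inv y \<otimes> b2 \<otimes> inv (inv y) = b2"
  "z \<otimes> b1 \<otimes> inv z = b1" "z \<otimes> b2 \<otimes> inv z = b2 \<otimes> b1"
  "inv z \<otimes> b1 \<otimes> inv (inv z) = b1" "inv z \<otimes> b2 \<otimes> inv (inv z) = b2 \<otimes> inv b1"
proof -
  show "y \<otimes> b2 \<otimes> inv y = b2" "z \<otimes> b1 \<otimes> inv z = b1" "z \<otimes> b2 \<otimes> inv z = b2 \<otimes> b1"
    by (simp_all add: y_b2 z_b1 z_b2 cancel_simps)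
  have "b2 \<otimes> (y \<otimes> b1 \<otimes> inv y) = b1"
  proof -
    have "b2 \<otimes> (y \<otimes> b1 \<otimes> inv y) = (b2 \<otimes> y) \<otimes> b1 \<otimes> inv y" by (simp add: m_assoc)
    also have "\<dots> = y \<otimes> (b2 \<otimes> b1) \<otimes> inv y" unfolding y_b2[symmetric] by (simp add: m_assoc)
    finally show ?thesis unfolding y_b2_b1 by (simp add: cancel_simps)
  qed
  then show "y \<otimes> b1 \<otimes> inv y = inv b2 \<otimes> b1"
    using inv_cancel_left(1)[of b2 "y \<otimes> b1 \<otimes> inv y"] by simp
  show "inv y \<otimes> b1 \<otimes> inv (inv y) = b2 \<otimes> b1" "inv y \<otimes> b2 \<otimes> inv (inv y) = b2"
    by (simp_all add: m_assoc flip: y_b2_b1 y_b2) (simp_all add: cancel_simps)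
  show "inv z \<otimes> b1 \<otimes> inv (inv z) = b1"
    by (simp add: m_assoc flip: z_b1) (simp add: cancel_simps)
  have "b2 \<otimes> z = z \<otimes> (b2 \<otimes> inv b1)"
  proof -
    have "z \<otimes> (b2 \<otimes> inv b1) = b2 \<otimes> (b1 \<otimes> z) \<otimes> inv b1"
      using z_b2 by (simp add: cancel_simps flip: m_assoc[of z b2])
    also have "\<dots> = b2 \<otimes> z" unfolding z_b1[symmetric] by (simp add: cancel_simps)
    finally show ?thesis by simp
  qed
  then show "inv z \<otimes> b2 \<otimes> inv (inv z) = b2 \<otimes> inv b1"
    by (simp add: cancel_simps)
qed

lemma N_intros [intro]: "b1 \<in> N" "b2 \<in> N" "inv b1 \<in> N" "inv b2 \<in> N"
  by (auto intro: generate.intros)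

lemma conj_N:
  assumes "n \<in> N" "h \<in> {y, z, inv y, inv z}"
  shows "h \<otimes> n \<otimes> inv h \<in> N"
proof (rule conj_generate[OF _ _ _ assms(1)])
  fix k assume "k \<in> {b1, b2}"
  then have "h \<otimes> k \<otimes> inv h \<in> {b1, b2, inv b2 \<otimes> b1, b2 \<otimes> b1, b2 \<otimes> inv b1}"
    using assms(2) conj_gens by auto
  moreover have "inv b2 \<otimes> b1 \<in> N" "b2 \<otimes> b1 \<in> N" "b2 \<otimes> inv b1 \<in> N"
    by (rule generate.eng; blast)+
  ultimately show "h \<otimes> k \<otimes> inv h \<in> N" by auto
qed (use assms in auto)

lemma conj_N_H:
  assumes n: "n \<in> N" and h: "h \<in> generate G {y, z}"
  shows "h \<otimes> n \<otimes> inv h \<in> N"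
proof -
  have "generate G {y, z} \<subseteq> {h \<in> carrier G. \<forall>n\<in>N. h \<otimes> n \<otimes> inv h \<in> N}"
  proof (rule generate_subset_of_left_closed)
    fix k v assume k: "k \<in> {y, z}" and v: "v \<in> {h \<in> carrier G. \<forall>n\<in>N. h \<otimes> n \<otimes> inv h \<in> N}"
    have "k' \<otimes> v \<in> {h \<in> carrier G. \<forall>n\<in>N. h \<otimes> n \<otimes> inv h \<in> N}" if k': "k' \<in> {y, z, inv y, inv z}" for k'
    proof -
      have c: "k' \<in> carrier G" "v \<in> carrier G" using k' v by auto
      have "k' \<otimes> v \<otimes> n \<otimes> inv (k' \<otimes> v) = k' \<otimes> (v \<otimes> n \<otimes> inv v) \<otimes> inv k'" if "n \<in> N" for n
        using c N_closed[OF that] by (simp add: m_assoc inv_mult_group)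
      then show ?thesis using conj_N[OF _ k'] v c by auto
    qed
    then show "k \<otimes> v \<in> {h \<in> carrier G. \<forall>n\<in>N. h \<otimes> n \<otimes> inv h \<in> N}"
      "inv k \<otimes> v \<in> {h \<in> carrier G. \<forall>n\<in>N. h \<otimes> n \<otimes> inv h \<in> N}" using k by auto
  qed (auto simp: N_closed)
  then show ?thesis using n h by blast
qed

text \<open>
  Since \<open>x = b1 \<otimes> z\<close>, the generators lie in the product of the normal subgroup \<open>N\<close> and the
  subgroup generated by \<open>y\<close> and \<open>z\<close>.
\<close>

lemma factor_N_H:
  assumes "g \<in> generate G {x, y, z}"
  shows "\<exists>n\<in>N. \<exists>h\<in>generate G {y, z}. g = n \<otimes> h"
proof -
  let ?H = "generate G {y, z}"
  let ?Y = "{n \<otimes> h | n h. n \<in> N \<and> h \<in> ?H}"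
  have Hc: "h \<in> carrier G" if "h \<in> ?H" for h
    using generate_in_carrier[of "{y, z}"] that by simp
  have step: "a \<otimes> v \<in> ?Y" if av: "a \<in> {y, z, inv y, inv z}" "v \<in> ?Y" for a v
  proof -
    from av obtain n h where nh: "v = n \<otimes> h" "n \<in> N" "h \<in> ?H" by auto
    have "a \<in> ?H" using av by (auto intro: generate.intros)
    moreover from av have "a \<in> carrier G" by auto
    then have "a \<otimes> v = (a \<otimes> n \<otimes> inv a) \<otimes> (a \<otimes> h)"
      using N_closed nh Hc by (simp add: cancel_simps)
    ultimately show ?thesis using conj_N[OF nh(2) av(1)] nh(3) by (auto intro!: generate.eng)
  qed
  have stepN: "a \<otimes> v \<in> ?Y" if av: "a \<in> N" "v \<in> ?Y" for a v
  proof -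
    from av obtain n h where nh: "v = n \<otimes> h" "n \<in> N" "h \<in> ?H" by auto
    then have "a \<otimes> v = (a \<otimes> n) \<otimes> h" using N_closed av Hc by (simp add: m_assoc)
    then show ?thesis using nh av by (auto intro!: generate.eng)
  qed
  have Yc: "?Y \<subseteq> carrier G" using N_closed Hc by auto
  have xe: "x = b1 \<otimes> z" "inv x = inv z \<otimes> inv b1"
    by (simp_all add: b1_z flip: inv_mult_group)
  have "generate G {x, y, z} \<subseteq> ?Y"
  proof (rule generate_subset_of_left_closed)
    have "\<one> \<in> N" "\<one> \<in> ?H" by (simp_all add: generate.one)
    then show "\<one> \<in> ?Y" by force
  next
    fix k v assume k: "k \<in> {x, y, z}" and v: "v \<in> ?Y"
    then have vc: "v \<in> carrier G" using Yc by blast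
    have "x \<otimes> v = b1 \<otimes> (z \<otimes> v)" "inv x \<otimes> v = inv z \<otimes> (inv b1 \<otimes> v)"
      using vc by (simp add: b1_z flip: m_assoc, simp add: xe(2) m_assoc)
    then have "x \<otimes> v \<in> ?Y" "inv x \<otimes> v \<in> ?Y"
      by (metis (lifting) insert_iff step stepN v N_intros)+
    then show "k \<otimes> v \<in> ?Y" "inv k \<otimes> v \<in> ?Y"
      using k step[OF _ v] by blast+
  qed (use Yc in auto)
  then show ?thesis using assms by blast
qed

text \<open>
  Under the map to \<open>SL\<^sub>2(\<int>)\<close> the elements \<open>y\<close> and \<open>inv z\<close> become the two elementary matrices
  with nonnegative entries, so this monoid consists of elements with nonnegative matrices.
\<close>

inductive_set pos :: "'a set" where
  one: "\<one> \<in> pos"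
| y: "p \<in> pos \<Longrightarrow> y \<otimes> p \<in> pos"
| z: "p \<in> pos \<Longrightarrow> inv z \<otimes> p \<in> pos"

lemma pos_closed: "p \<in> pos \<Longrightarrow> p \<in> carrier G"
  by (induction rule: pos.induct) auto

lemma W_closed: "w \<in> W \<Longrightarrow> w \<in> carrier G"
  using generate_in_carrier[of "{z, \<Delta> \<otimes> \<Delta>}"] by simp

lemma \<Delta>_y: "\<Delta> \<otimes> y = z \<otimes> \<Delta>" and \<Delta>_z: "\<Delta> \<otimes> z = y \<otimes> \<Delta>"
  by (simp_all add: \<Delta>_def m_assoc braid_assoc braid_assoc')

lemma \<Delta>_inv_y: "\<Delta> \<otimes> inv y = inv z \<otimes> \<Delta>" and \<Delta>_inv_z: "\<Delta> \<otimes> inv z = inv y \<otimes> \<Delta>"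
  by (rule intertwine_inv; simp add: \<Delta>_y \<Delta>_z)+

lemma \<Delta>2_commutes:
  assumes "h \<in> generate G {y, z}"
  shows "h \<otimes> (\<Delta> \<otimes> \<Delta>) = \<Delta> \<otimes> \<Delta> \<otimes> h"
proof (rule commutes_generate[OF _ _ _ assms])
  fix k assume "k \<in> {y, z}"
  moreover have "y \<otimes> (\<Delta> \<otimes> \<Delta>) = \<Delta> \<otimes> \<Delta> \<otimes> y" "z \<otimes> (\<Delta> \<otimes> \<Delta>) = \<Delta> \<otimes> \<Delta> \<otimes> z"
    by (simp_all add: m_assoc \<Delta>_y \<Delta>_z) (simp_all add: \<Delta>_y \<Delta>_z flip: m_assoc)
  ultimately show "k \<otimes> (\<Delta> \<otimes> \<Delta>) = \<Delta> \<otimes> \<Delta> \<otimes> k" by blast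
qed auto

lemma \<Delta>_in_H: "\<Delta> \<in> generate G {y, z}"
  unfolding \<Delta>_def by (intro generate.eng generate.incl) auto

lemma pos_in_H: "p \<in> pos \<Longrightarrow> p \<in> generate G {y, z}"
  by (induction rule: pos.induct) (auto intro: generate.intros)

text \<open>
  Modulo its center, generated by \<open>\<Delta> \<otimes> \<Delta>\<close>, the braid group on three strands acts on the projective
  line over the rationals with the class of \<open>W\<close> as the stabilizer of one point. The elements
  \<open>p \<otimes> d\<close> move this point to the nonnegative rationals and infinity, and \<open>\<Delta>\<close> exchanges a number
  with its negative reciprocal; hence all cosets of \<open>W\<close> are reached. Concretely, left
  multiplication by \<open>z\<close> is absorbed by the identities
  \<open>z \<otimes> y = \<Delta> \<otimes> inv z\<close> and \<open>\<Delta> \<otimes> inv y = y \<otimes> z\<close>.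
\<close>

lemma normal_form_H:
  assumes "h \<in> generate G {y, z}"
  shows "\<exists>e\<in>{\<one>, \<Delta>}. \<exists>p\<in>pos. \<exists>d\<in>{\<one>, \<Delta>}. \<exists>w\<in>W. h = e \<otimes> (p \<otimes> (d \<otimes> w))"
proof -
  let ?D = "\<Delta> \<otimes> \<Delta>"
  let ?Y = "{e \<otimes> (p \<otimes> (d \<otimes> w)) | e p d w. e \<in> {\<one>, \<Delta>} \<and> p \<in> pos \<and> d \<in> {\<one>, \<Delta>} \<and> w \<in> W}"
  note cl = pos_closed W_closed
  have Yc: "?Y \<subseteq> carrier G" using cl by auto
  have YI: "e \<otimes> (p \<otimes> (d \<otimes> w)) \<in> ?Y"
    if "e \<in> {\<one>, \<Delta>}" "p \<in> pos" "d \<in> {\<one>, \<Delta>}" "w \<in> W" for e p d w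
    using that by blast
  have W1: "\<one> \<in> W" "z \<in> W" "inv z \<in> W" "?D \<in> W" "inv ?D \<in> W"
    by (auto intro: generate.intros)
  have DY: "k \<otimes> v \<in> ?Y" if k: "k \<in> {?D, inv ?D}" and v: "v \<in> ?Y" for k v
  proof -
    from v obtain e p d w where v: "v = e \<otimes> (p \<otimes> (d \<otimes> w))"
      "e \<in> {\<one>, \<Delta>}" "p \<in> pos" "d \<in> {\<one>, \<Delta>}" "w \<in> W" by blast
    let ?g = "e \<otimes> p \<otimes> d"
    have ed: "e \<in> generate G {y, z}" "d \<in> generate G {y, z}"
      using v \<Delta>_in_H by (auto intro: generate.one)
    have g: "?g \<in> generate G {y, z}"
      by (rule generate.eng[OF generate.eng[OF ed(1) pos_in_H[OF v(3)]] ed(2)])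
    have edc: "e \<in> carrier G" "d \<in> carrier G" "p \<in> carrier G" "w \<in> carrier G" using v cl by auto
    have "?g \<otimes> ?D = ?D \<otimes> ?g" by (rule \<Delta>2_commutes[OF g])
    then have "?g \<otimes> k = k \<otimes> ?g" using k commutes_inv[of ?D ?g] edc by auto
    moreover have "v = ?g \<otimes> w" "k \<in> carrier G" using v edc k by (auto simp: m_assoc)
    ultimately have "k \<otimes> v = ?g \<otimes> (k \<otimes> w)"
      using edc by (simp flip: m_assoc)
    then have "k \<otimes> v = e \<otimes> (p \<otimes> (d \<otimes> (k \<otimes> w)))" using edc \<open>k \<in> carrier G\<close> by (simp add: m_assoc)
    moreover have "k \<otimes> w \<in> W" using k v W1 by (auto intro: generate.eng)
    ultimately show ?thesis using YI[OF v(2,3,4)] by simp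
  qed
  have \<Delta>Y: "\<Delta> \<otimes> v \<in> ?Y" if v: "v \<in> ?Y" for v
  proof -
    from v obtain e p d w where v': "v = e \<otimes> (p \<otimes> (d \<otimes> w))"
      "e \<in> {\<one>, \<Delta>}" "p \<in> pos" "d \<in> {\<one>, \<Delta>}" "w \<in> W" by blast
    let ?u = "p \<otimes> (d \<otimes> w)"
    have u: "?u \<in> carrier G" using v' cl by auto
    have uY: "?u \<in> ?Y" using YI[of \<one> p d w] v' u by simp
    show ?thesis
    proof (cases "e = \<one>")
      case True
      then show ?thesis using YI[of \<Delta> p d w] v' u by simp
    next
      case False
      then have "\<Delta> \<otimes> v = ?D \<otimes> ?u" using v' u by (auto simp: m_assoc)
      then show ?thesis using DY[of ?D ?u] uY by simp
    qed
  qed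
  have inv\<Delta>Y: "inv \<Delta> \<otimes> v \<in> ?Y" if v: "v \<in> ?Y" for v
  proof -
    have vc: "v \<in> carrier G" using v Yc by blast
    have "inv \<Delta> \<otimes> v = inv ?D \<otimes> (\<Delta> \<otimes> v)"
      using vc by (simp add: inv_mult_group cancel_simps)
    then show ?thesis using DY[of "inv ?D"] \<Delta>Y[OF v] by simp
  qed
  have posY: "p \<otimes> (d \<otimes> w) \<in> ?Y" if "p \<in> pos" "d \<in> {\<one>, \<Delta>}" "w \<in> W" for p d w
  proof -
    have "p \<otimes> (d \<otimes> w) \<in> carrier G" using that cl by auto
    then show ?thesis using YI[of \<one> p d w] that by simp
  qed
  have \<Delta>posY: "\<Delta> \<otimes> (p \<otimes> (d \<otimes> w)) \<in> ?Y" if "p \<in> pos" "d \<in> {\<one>, \<Delta>}" "w \<in> W" for p d w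
    using YI[of \<Delta> p d w] that by auto
  have zy: "z \<otimes> (y \<otimes> u) = \<Delta> \<otimes> (inv z \<otimes> u)" if "u \<in> carrier G" for u
    using that by (simp add: \<Delta>_def cancel_simps flip: braid_assoc(3))
  have izD: "inv z \<otimes> (\<Delta> \<otimes> u) = \<Delta> \<otimes> (inv y \<otimes> u)" if "u \<in> carrier G" for u
    using that \<Delta>_inv_y by (simp flip: m_assoc)
  have iyD: "inv y \<otimes> (\<Delta> \<otimes> u) = \<Delta> \<otimes> (inv z \<otimes> u)" if "u \<in> carrier G" for u
    using that \<Delta>_inv_z by (simp flip: m_assoc)
  have zD: "z \<otimes> (\<Delta> \<otimes> u) = \<Delta> \<otimes> (y \<otimes> u)" if "u \<in> carrier G" for u
    using that \<Delta>_y by (simp flip: m_assoc)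
  have Diy: "\<Delta> \<otimes> (inv y \<otimes> u) = y \<otimes> (z \<otimes> u)" if "u \<in> carrier G" for u
    using that by (simp add: \<Delta>_def cancel_simps)
  have zY: "z \<otimes> v \<in> ?Y" and izY: "inv z \<otimes> v \<in> ?Y" if v: "v \<in> ?Y" for v
  proof -
    from v obtain e p d w where v: "v = e \<otimes> (p \<otimes> (d \<otimes> w))"
      "e \<in> {\<one>, \<Delta>}" "p \<in> pos" "d \<in> {\<one>, \<Delta>}" "w \<in> W" by blast
    have dw: "d \<in> carrier G" "w \<in> carrier G" "p \<in> carrier G" using v cl by auto
    have W: "z \<otimes> w \<in> W" "inv z \<otimes> w \<in> W" using v W1 by (auto intro: generate.eng)
    have y1: "y \<otimes> \<one> \<in> pos" by (rule pos.y[OF pos.one])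
    show "z \<otimes> v \<in> ?Y"
    proof (cases "e = \<one>")
      case True
      then have v1: "v = p \<otimes> (d \<otimes> w)" using v dw by simp
      from v(3) show ?thesis
      proof (cases rule: pos.cases)
        case one
        show ?thesis
        proof (cases "d = \<one>")
          case True
          then show ?thesis using v1 one W posY[of \<one> \<one> "z \<otimes> w"] dw W_closed by (simp add: pos.one)
        next
          case False
          then have "z \<otimes> v = \<Delta> \<otimes> (y \<otimes> \<one> \<otimes> (\<one> \<otimes> w))" using v1 one v dw by (simp add: zD)
          then show ?thesis using \<Delta>posY[OF y1, of \<one> w] v by simp
        qed
      next
        case (y q)
        then have q: "q \<in> carrier G" using cl by simp
        have "z \<otimes> v = \<Delta> \<otimes> (inv z \<otimes> q \<otimes> (d \<otimes> w))" using v1 y q dw by (simp add: zy m_assoc)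
        then show ?thesis using \<Delta>posY[OF pos.z[OF y(2)]] v by simp
      next
        case (z q)
        then have q: "q \<in> carrier G" using cl by simp
        have "z \<otimes> v = q \<otimes> (d \<otimes> w)" using v1 z q dw by (simp add: cancel_simps)
        then show ?thesis using posY z v by simp
      qed
    next
      case False
      then have "z \<otimes> v = \<Delta> \<otimes> (y \<otimes> p \<otimes> (d \<otimes> w))" using v dw by (simp add: zD m_assoc)
      then show ?thesis using \<Delta>posY[OF pos.y[OF v(3)]] v by simp
    qed
    show "inv z \<otimes> v \<in> ?Y"
    proof (cases "e = \<one>")
      case True
      then have "inv z \<otimes> v = inv z \<otimes> p \<otimes> (d \<otimes> w)" using v dw by (simp add: m_assoc)
      then show ?thesis using posY[OF pos.z[OF v(3)]] v by simp
    next
      case False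
      then have v1: "inv z \<otimes> v = \<Delta> \<otimes> (inv y \<otimes> (p \<otimes> (d \<otimes> w)))" using v dw by (simp add: izD)
      from v(3) show ?thesis
      proof (cases rule: pos.cases)
        case one
        show ?thesis
        proof (cases "d = \<one>")
          case True
          then have "inv z \<otimes> v = y \<otimes> \<one> \<otimes> (\<one> \<otimes> (z \<otimes> w))" using v1 one dw by (simp add: Diy)
          then show ?thesis using posY[OF y1, of \<one> "z \<otimes> w"] W by simp
        next
          case False
          then have "inv z \<otimes> v = \<Delta> \<otimes> (\<Delta> \<otimes> (inv z \<otimes> w))"
            using v1 one v dw by (simp add: iyD)
          also have "\<dots> = \<Delta> \<otimes> (\<one> \<otimes> (\<Delta> \<otimes> (inv z \<otimes> w)))" using dw by simp
          finally show ?thesis using \<Delta>posY[OF pos.one, of \<Delta> "inv z \<otimes> w"] W by simp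
        qed
      next
        case (y q)
        then have q: "q \<in> carrier G" using cl by simp
        have "inv z \<otimes> v = \<Delta> \<otimes> (q \<otimes> (d \<otimes> w))" using v1 y q dw by (simp add: cancel_simps)
        then show ?thesis using \<Delta>posY y v by simp
      next
        case (z q)
        then have q: "q \<in> carrier G" using cl by simp
        have "inv z \<otimes> v = y \<otimes> q \<otimes> (d \<otimes> w)" using v1 z q dw by (simp add: cancel_simps Diy)
        then show ?thesis using posY[OF pos.y[OF z(2)]] v by simp
      qed
    qed
  qed
  have "generate G {y, z} \<subseteq> ?Y"
  proof (rule generate_subset_of_left_closed)
    show "\<one> \<in> ?Y" using posY[OF pos.one, of \<one> \<one>] W1 by simp
  next
    fix k v assume k: "k \<in> {y, z}" and v: "v \<in> ?Y"
    then have vc: "v \<in> carrier G" using Yc by blast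
    have "y \<otimes> v = \<Delta> \<otimes> (z \<otimes> (inv \<Delta> \<otimes> v))" "inv y \<otimes> v = \<Delta> \<otimes> (inv z \<otimes> (inv \<Delta> \<otimes> v))"
      using vc \<Delta>_z \<Delta>_inv_z by (simp_all flip: m_assoc) (simp_all add: cancel_simps)
    then have "y \<otimes> v \<in> ?Y" "inv y \<otimes> v \<in> ?Y"
      using \<Delta>Y zY izY inv\<Delta>Y v by (metis (lifting))+
    then show "k \<otimes> v \<in> ?Y" "inv k \<otimes> v \<in> ?Y" using k zY[OF v] izY[OF v] by blast+
  qed (use Yc in auto)
  then show ?thesis using assms by blast
qed

lemma W_subset_H: "W \<subseteq> generate G {y, z}"
proof
  fix w assume "w \<in> W"
  then show "w \<in> generate G {y, z}"
  proof (induction rule: generate.induct)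
    case (inv h)
    have "h \<in> generate G {y, z}" using inv \<Delta>_in_H by (auto intro: generate.intros)
    then show ?case by (intro generate_m_inv_closed) auto
  qed (use \<Delta>_in_H in \<open>auto intro: generate.intros\<close>)
qed

lemma z_\<xi>: "z \<otimes> \<xi> = \<xi> \<otimes> z"
proof -
  have "z \<otimes> \<xi> = b1 \<otimes> (z \<otimes> (\<Delta> \<otimes> \<Delta>))"
    using z_b1 by (simp add: \<xi>_def flip: m_assoc[of _ _ "\<Delta> \<otimes> \<Delta>"])
  also have "z \<otimes> (\<Delta> \<otimes> \<Delta>) = \<Delta> \<otimes> \<Delta> \<otimes> z"
    by (rule \<Delta>2_commutes) (auto intro: generate.incl)
  finally show ?thesis by (simp add: \<xi>_def m_assoc)
qed

text \<open>
  The element \<open>\<Delta> \<otimes> \<Delta>\<close> may be replaced by \<open>\<xi>\<close>, which differs from it by an element of the normal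
  subgroup \<open>N\<close>. The reason to do so is that the Burau matrix of \<open>\<xi>\<close> preserves the start region of
  the ping-pong below.
\<close>

lemma factor_N_W:
  assumes "n \<in> N" "w \<in> W"
  shows "\<exists>n'\<in>N. \<exists>k\<in>generate G {z, \<xi>}. n \<otimes> w = n' \<otimes> k"
proof -
  let ?Z = "generate G {z, \<xi>}"
  let ?D = "\<Delta> \<otimes> \<Delta>"
  let ?Y = "{n \<otimes> h | n h. n \<in> N \<and> h \<in> ?Z}"
  have Zc: "h \<in> carrier G" if "h \<in> ?Z" for h
    using generate_in_carrier[of "{z, \<xi>}"] that by simp
  have Yc: "?Y \<subseteq> carrier G" using N_closed Zc by auto
  have stepN: "a \<otimes> v \<in> ?Y" if av: "a \<in> N" "v \<in> ?Y" for a v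
  proof -
    from av obtain n h where nh: "v = n \<otimes> h" "n \<in> N" "h \<in> ?Z" by auto
    then have "a \<otimes> v = (a \<otimes> n) \<otimes> h" using N_closed av Zc by (simp add: m_assoc)
    then show ?thesis using nh av by (auto intro!: generate.eng)
  qed
  have stepW: "k \<otimes> v \<in> ?Y" if k: "k \<in> W" "a \<in> N" "a \<otimes> k \<in> ?Z" and v: "v \<in> ?Y" for a k v
  proof -
    from v obtain n h where nh: "v = n \<otimes> h" "n \<in> N" "h \<in> ?Z" by auto
    have kc: "k \<in> carrier G" "a \<in> carrier G" using k W_closed N_closed by auto
    have ia: "inv a \<in> N" using k by (intro generate_m_inv_closed) auto
    have "k \<otimes> v = (k \<otimes> n \<otimes> inv k) \<otimes> inv a \<otimes> ((a \<otimes> k) \<otimes> h)"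
      using nh kc N_closed Zc by (simp add: cancel_simps)
    moreover have "k \<otimes> n \<otimes> inv k \<in> N" using k nh W_subset_H by (intro conj_N_H) auto
    ultimately show ?thesis using nh k ia by (blast intro: generate.eng)
  qed
  have D: "?D \<in> W" "inv ?D \<in> W" "z \<in> W" "inv z \<in> W" by (auto intro: generate.intros)
  have D_conj: "\<xi> \<in> ?Z" "inv \<xi> \<in> ?Z" "z \<in> ?Z" "inv z \<in> ?Z" by (auto intro: generate.intros)
  have a: "inv ?D \<otimes> inv b1 \<otimes> ?D \<in> N"
    using conj_N_H[of "inv b1" "inv ?D"] W_subset_H D by auto
  have "W \<subseteq> ?Y"
  proof (rule generate_subset_of_left_closed)
    have "\<one> \<in> N" "\<one> \<in> ?Z" by (simp_all add: generate.one)
    then show "\<one> \<in> ?Y" by force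
  next
    fix k v assume k: "k \<in> {z, ?D}" and v: "v \<in> ?Y"
    have "?D \<otimes> v \<in> ?Y" using stepW[OF D(1) N_intros(1) _ v] D_conj by (simp add: \<xi>_def)
    moreover have "inv ?D \<otimes> v \<in> ?Y"
    proof (rule stepW[OF D(2) a _ v])
      show "inv ?D \<otimes> inv b1 \<otimes> ?D \<otimes> inv ?D \<in> ?Z"
        using D_conj by (simp add: \<xi>_def inv_mult_group cancel_simps)
    qed
    moreover have "z \<otimes> v \<in> ?Y" "inv z \<otimes> v \<in> ?Y"
      using stepW[OF D(3) generate.one _ v] stepW[OF D(4) generate.one _ v] D_conj by auto
    ultimately show "k \<otimes> v \<in> ?Y" "inv k \<otimes> v \<in> ?Y" using k by blast+
  qed (use Yc in auto)
  then show ?thesis using stepN[OF assms(1)] assms(2) by blast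
qed

end

section \<open>An action of the braid group on triples\<close>

text \<open>The index \<open>1\<close> of a generator should not be rewritten to \<open>Suc 0\<close>.\<close>

declare One_nat_def [simp del]

lemma (in group) generate_eq_word_values:
  assumes f: "f \<in> X \<rightarrow> carrier G"
  shows "generate G (f ` X) = word_value G f ` gwords X"
proof
  have fX: "f ` X \<subseteq> carrier G" using f by auto
  show "generate G (f ` X) \<subseteq> word_value G f ` gwords X"
  proof (rule generate_subset_of_left_closed[OF fX])
    have step: "word_value G f ((x, b) # w) \<in> word_value G f ` gwords X"
      if "x \<in> X" "w \<in> gwords X" for x b w
      using that by (intro imageI) simp
    fix k v assume "k \<in> f ` X" "v \<in> word_value G f ` gwords X"
    then obtain x w where "k = f x" "x \<in> X" "v = word_value G f w" "w \<in> gwords X" by auto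
    with step[of x w True] step[of x w False]
    show "k \<otimes> v \<in> word_value G f ` gwords X" "inv k \<otimes> v \<in> word_value G f ` gwords X" by simp_all
  next
    have "word_value G f [] \<in> word_value G f ` gwords X" by (intro imageI) simp
    then show "\<one> \<in> word_value G f ` gwords X" by simp
  qed (use f in auto)
next
  show "word_value G f ` gwords X \<subseteq> generate G (f ` X)"
  proof clarify
    fix w assume "w \<in> gwords X"
    then show "word_value G f w \<in> generate G (f ` X)"
    proof (induction w)
      case (Cons p w)
      then show ?case by (cases p) (auto intro!: generate.eng intro: generate.incl generate.inv)
    qed (simp add: generate.one)
  qed
qed

definition triples :: "('g, 'm) monoid_scheme \<Rightarrow> ('g \<times> 'g \<times> 'g) set" where
  "triples G = carrier G \<times> carrier G \<times> carrier G"

text \<open>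
  Homomorphisms from the free group on three letters \<open>r, a, b\<close> to \<open>G\<close> are triples, and
  automorphisms of this free group act on them by substitution. The three formulas are such
  substitutions; they satisfy the braid relations, and under them \<open>b\<^sub>1\<close> and \<open>b\<^sub>2\<close> become
  \<open>r \<mapsto> a r\<close> and \<open>r \<mapsto> b r\<close>.
\<close>

definition triple_gen :: "('g, 'm) monoid_scheme \<Rightarrow> nat \<Rightarrow> 'g \<times> 'g \<times> 'g \<Rightarrow> 'g \<times> 'g \<times> 'g" where
  "triple_gen G i = (\<lambda>(c, a, b) \<in> triples G.
    if i = 1 then (a \<otimes>\<^bsub>G\<^esub> c, a, b \<otimes>\<^bsub>G\<^esub> inv\<^bsub>G\<^esub> a)
    else if i = 2 then (c, b \<otimes>\<^bsub>G\<^esub> a, b)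
    else (c, a, b \<otimes>\<^bsub>G\<^esub> inv\<^bsub>G\<^esub> a))"

definition triple_act :: "('g, 'm) monoid_scheme \<Rightarrow> nat gword set \<Rightarrow> 'g \<times> 'g \<times> 'g \<Rightarrow> 'g \<times> 'g \<times> 'g" where
  "triple_act G = pres_lift (BijGroup (triples G)) (triple_gen G)"

context group
begin

lemma triple_gen_apply:
  assumes "c \<in> carrier G" "a \<in> carrier G" "b \<in> carrier G"
  shows "triple_gen G (1) (c, a, b) = (a \<otimes> c, a, b \<otimes> inv a)"
    "triple_gen G 2 (c, a, b) = (c, b \<otimes> a, b)"
    "triple_gen G 3 (c, a, b) = (c, a, b \<otimes> inv a)"
  using assms by (simp_all add: triple_gen_def triples_def)

lemma triple_gen_Bij: "triple_gen G i \<in> Bij (triples G)"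
proof -
  define g where "g = (\<lambda>(c, a, b).
    if i = 1 then (inv a \<otimes> c, a, b \<otimes> a) else if i = 2 then (c, inv b \<otimes> a, b) else (c, a, b \<otimes> a))"
  have "bij_betw (triple_gen G i) (triples G) (triples G)"
    by (rule bij_betw_byWitness[where f' = g])
      (auto simp: triple_gen_def triples_def g_def inv_cancel_left m_assoc split: if_splits)
  then show ?thesis by (simp add: Bij_def triple_gen_def)
qed

lemma triple_gen_rels:
  assumes "(r, s) \<in> braid_rels 4"
  shows "word_value (BijGroup (triples G)) (triple_gen G) r =
    word_value (BijGroup (triples G)) (triple_gen G) s"
proof -
  let ?S = "triples G" and ?f = "triple_gen G"
  have wvNil: "word_value (BijGroup ?S) ?f [] = (\<lambda>s\<in>?S. s)"
    by (simp add: word_value_def BijGroup_def)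
  have wvCons: "word_value (BijGroup ?S) ?f ((i, True) # w) = compose ?S (?f i) (word_value (BijGroup ?S) ?f w)"
    if "word_value (BijGroup ?S) ?f w \<in> Bij ?S" for i w
    using that triple_gen_Bij by (simp add: word_value_def BijGroup_def)
  have B: "compose ?S (?f i) g \<in> Bij ?S" if "g \<in> Bij ?S" for i g
    by (rule compose_Bij[OF triple_gen_Bij that])
  have wv1: "word_value (BijGroup ?S) ?f [(i, True)] = ?f i" for i
    using wvCons[of "[]" i] triple_gen_Bij[of i]
    by (simp add: wvNil id_Bij compose_Id[OF Bij_imp_funcset Bij_imp_extensional])
  have wv2: "word_value (BijGroup ?S) ?f [(i, True), (j, True)] = compose ?S (?f i) (?f j)" for i j
    using wvCons[of "[(j, True)]" i] triple_gen_Bij[of j] by (simp add: wv1)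
  have wv3: "word_value (BijGroup ?S) ?f [(i, True), (j, True), (k, True)] =
      compose ?S (?f i) (compose ?S (?f j) (?f k))" for i j k
    using wvCons[of "[(j, True), (k, True)]" i] B[OF triple_gen_Bij] by (simp add: wv2)
  note S = triples_def
  have 13: "compose ?S (?f 1) (?f 3) = compose ?S (?f 3) (?f 1)"
    and 12: "compose ?S (?f 1) (compose ?S (?f 2) (?f 1)) = compose ?S (?f 2) (compose ?S (?f 1) (?f 2))"
    and 23: "compose ?S (?f 2) (compose ?S (?f 3) (?f 2)) = compose ?S (?f 3) (compose ?S (?f 2) (?f 3))"
    by (auto simp: fun_eq_iff compose_def S triple_gen_apply inv_mult_group m_assoc inv_cancel_left)
  from assms consider
      i j where "r = [(i, True), (j, True)]" "s = [(j, True), (i, True)]"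
        "i \<in> {1..<4}" "j \<in> {1..<4}" "i + 2 \<le> j"
    | i where "r = [(i, True), (i + 1, True), (i, True)]"
        "s = [(i + 1, True), (i, True), (i + 1, True)]" "i \<in> {1..<4}" "i + 1 \<in> {1..<4}"
    unfolding braid_rels_def by blast
  then show ?thesis
  proof cases
    case (1 i j)
    then have "i = 1" "j = 3" by auto
    then show ?thesis using 1 13 by (simp add: wv2)
  next
    case (2 i)
    then have "i = 1 \<and> i + 1 = 2 \<or> i = 2 \<and> i + 1 = 3" by auto
    then show ?thesis using 2(1,2) 12 23 by (elim disjE conjE) (simp_all only: wv3)
  qed
qed

lemma triple_act_hom: "triple_act G \<in> hom B4 (BijGroup (triples G))"
  unfolding triple_act_def braid_group_def
  by (rule group.pres_lift(1)[OF group_BijGroup])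
    (auto simp: triple_gen_Bij BijGroup_def[of "triples G", THEN arg_cong[of _ _ carrier]] triple_gen_rels)

lemma triple_act_sigma: "i \<in> {1..<4} \<Longrightarrow> triple_act G (braid_sigma i) = triple_gen G i"
  unfolding triple_act_def braid_sigma_def
  by (rule group.pres_lift(2)[OF group_BijGroup])
    (auto simp: triple_gen_Bij BijGroup_def[of "triples G", THEN arg_cong[of _ _ carrier]] triple_gen_rels)

lemma triple_act_Bij: "g \<in> carrier B4 \<Longrightarrow> triple_act G g \<in> Bij (triples G)"
  using triple_act_hom by (auto simp: hom_def BijGroup_def)

lemma triple_act_mult:
  assumes "g \<in> carrier B4" "h \<in> carrier B4" "s \<in> triples G"
  shows "triple_act G (g \<otimes>\<^bsub>B4\<^esub> h) s = triple_act G g (triple_act G h s)"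
proof -
  have "triple_act G (g \<otimes>\<^bsub>B4\<^esub> h) = triple_act G g \<otimes>\<^bsub>BijGroup (triples G)\<^esub> triple_act G h"
    by (rule hom_mult[OF triple_act_hom assms(1,2)])
  then show ?thesis
    using triple_act_Bij[OF assms(1)] triple_act_Bij[OF assms(2)] assms(3)
    by (simp add: BijGroup_def compose_def)
qed

lemma triple_act_one:
  assumes "s \<in> triples G"
  shows "triple_act G \<one>\<^bsub>B4\<^esub> s = s"
  using hom_one[OF triple_act_hom group_braid_group group_BijGroup] assms
  by (simp add: BijGroup_def)

lemma triple_act_inv:
  assumes "g \<in> carrier B4" "s \<in> triples G" "triple_act G g s = s'"
  shows "triple_act G (inv\<^bsub>B4\<^esub> g) s' = s"
  using triple_act_mult[of "inv\<^bsub>B4\<^esub> g" g s] assms triple_act_one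
  by (simp add: group.inv_closed[OF group_braid_group] group.l_inv[OF group_braid_group])

end

lemma braid_sigma_closed: "i \<in> {1..<4} \<Longrightarrow> braid_sigma i \<in> carrier B4"
  by (simp add: braid_sigma_def pres_gen_def braid_group_def presented_group_carrier_class)

interpretation B: braid_triple B4 "braid_sigma 1" "braid_sigma 2" "braid_sigma 3"
proof (intro braid_triple.intro braid_triple_axioms.intro group_braid_group braid_sigma_closed)
  have mult: "pres_rel {1..<4} (braid_rels 4) `` {u} \<otimes>\<^bsub>B4\<^esub> pres_rel {1..<4} (braid_rels 4) `` {v}
      = pres_rel {1..<4} (braid_rels 4) `` {u @ v}"
    if "u \<in> gwords {1..<4}" "v \<in> gwords {1..<4}" for u v
    using that unfolding braid_group_def by (rule presented_group_mult_class)
  have rel: "pres_rel {1..<4} (braid_rels 4) `` {r} = pres_rel {1..<4} (braid_rels 4) `` {s}"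
    if "(r, s) \<in> braid_rels 4" "r \<in> gwords {1..<4}" "s \<in> gwords {1..<4}" for r s
    using pres_rel.rel[of "[]" "{1..<4}" "[]" r s] that by (intro pres_class_eq) simp
  have r: "([(1, True), (3, True)], [(3, True), (1, True)]) \<in> braid_rels 4"
    "([(1, True), (2, True), (1, True)], [(2, True), (1, True), (2, True)]) \<in> braid_rels 4"
    "([(2, True), (3, True), (2, True)], [(3, True), (2, True), (3, True)]) \<in> braid_rels 4"
    by (auto simp: braid_rels_def)
  show "braid_sigma 1 \<otimes>\<^bsub>B4\<^esub> braid_sigma 3 = braid_sigma 3 \<otimes>\<^bsub>B4\<^esub> braid_sigma 1"
    "braid_sigma 1 \<otimes>\<^bsub>B4\<^esub> braid_sigma 2 \<otimes>\<^bsub>B4\<^esub> braid_sigma 1 =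
      braid_sigma 2 \<otimes>\<^bsub>B4\<^esub> braid_sigma 1 \<otimes>\<^bsub>B4\<^esub> braid_sigma 2"
    "braid_sigma 2 \<otimes>\<^bsub>B4\<^esub> braid_sigma 3 \<otimes>\<^bsub>B4\<^esub> braid_sigma 2 =
      braid_sigma 3 \<otimes>\<^bsub>B4\<^esub> braid_sigma 2 \<otimes>\<^bsub>B4\<^esub> braid_sigma 3"
    using r[THEN rel] by (simp_all add: braid_sigma_def pres_gen_def mult)
qed auto

lemma carrier_B4: "carrier B4 = generate B4 {braid_sigma 1, braid_sigma 2, braid_sigma 3}"
proof -
  let ?c = "\<lambda>w. pres_rel {1..<4} (braid_rels 4) `` {w}"
  let ?K = "{braid_sigma 1, braid_sigma 2, braid_sigma 3}"
  have mult: "?c u \<otimes>\<^bsub>B4\<^esub> ?c v = ?c (u @ v)" if "u \<in> gwords {1..<4}" "v \<in> gwords {1..<4}" for u v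
    using that unfolding braid_group_def by (rule presented_group_mult_class)
  have one: "?c [] = \<one>\<^bsub>B4\<^esub>" by (simp add: braid_group_def presented_group_def)
  have "{1..<4} = {1, 2, 3::nat}" by auto
  then have K: "?K = braid_sigma ` {1..<4}" by simp
  have letter: "?c [(i, b)] \<in> generate B4 ?K" if i: "i \<in> {1..<4}" for i b
  proof (cases b)
    case True
    then show ?thesis unfolding K using i
      by (auto simp: braid_sigma_def pres_gen_def intro: generate.incl)
  next
    case False
    have "?c [(i, False)] \<otimes>\<^bsub>B4\<^esub> ?c [(i, True)] = \<one>\<^bsub>B4\<^esub>"
      using pres_rel.cancel[of "[]" "{1..<4}" "[]" i False "braid_rels 4"] i
      by (simp add: mult pres_class_eq flip: one)
    then have "inv\<^bsub>B4\<^esub> (braid_sigma i) = ?c [(i, False)]"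
      using i by (intro B.inv_equality)
        (auto simp: braid_sigma_def pres_gen_def braid_group_def presented_group_carrier_class)
    then show ?thesis
      using False i generate.inv[of "braid_sigma i" "braid_sigma ` {1..<4}" B4] by (simp add: K)
  qed
  have "?c w \<in> generate B4 ?K" if "w \<in> gwords {1..<4}" for w
    using that
  proof (induction w)
    case Nil
    show ?case by (simp add: one generate.one)
  next
    case (Cons p w)
    obtain i b where p: "p = (i, b)" by fastforce
    have "?c (p # w) = ?c [(i, b)] \<otimes>\<^bsub>B4\<^esub> ?c w" using Cons.prems by (simp add: mult p)
    then show ?case using Cons letter p by (auto intro: generate.eng)
  qed
  then have "carrier B4 \<subseteq> generate B4 ?K"
    unfolding braid_group_def by (auto elim: presented_group_cases)
  then show ?thesis using B.generate_incl[of ?K] by auto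
qed

lemma B_b1: "B.b1 = braid_b1" and B_b2: "B.b2 = braid_b2"
  by (simp_all add: B.b1_def B.b2_def braid_b1_def braid_b2_def)

context group
begin

lemma triple_act_simps:
  assumes "c \<in> carrier G" "a \<in> carrier G" "b \<in> carrier G"
  shows "triple_act G (braid_sigma (1)) (c, a, b) = (a \<otimes> c, a, b \<otimes> inv a)"
    "triple_act G (braid_sigma 2) (c, a, b) = (c, b \<otimes> a, b)"
    "triple_act G (braid_sigma 3) (c, a, b) = (c, a, b \<otimes> inv a)"
    "triple_act G (inv\<^bsub>B4\<^esub> (braid_sigma (1))) (c, a, b) = (inv a \<otimes> c, a, b \<otimes> a)"
    "triple_act G (inv\<^bsub>B4\<^esub> (braid_sigma 2)) (c, a, b) = (c, inv b \<otimes> a, b)"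
    "triple_act G (inv\<^bsub>B4\<^esub> (braid_sigma 3)) (c, a, b) = (c, a, b \<otimes> a)"
proof -
  have s: "triple_act G (braid_sigma (1)) = triple_gen G (1)"
    "triple_act G (braid_sigma 2) = triple_gen G 2" "triple_act G (braid_sigma 3) = triple_gen G 3"
    by (simp_all add: triple_act_sigma)
  show "triple_act G (braid_sigma (1)) (c, a, b) = (a \<otimes> c, a, b \<otimes> inv a)"
    "triple_act G (braid_sigma 2) (c, a, b) = (c, b \<otimes> a, b)"
    "triple_act G (braid_sigma 3) (c, a, b) = (c, a, b \<otimes> inv a)"
    using assms by (simp_all only: s triple_gen_apply)
  show "triple_act G (inv\<^bsub>B4\<^esub> (braid_sigma (1))) (c, a, b) = (inv a \<otimes> c, a, b \<otimes> a)"
    "triple_act G (inv\<^bsub>B4\<^esub> (braid_sigma 2)) (c, a, b) = (c, inv b \<otimes> a, b)"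
    "triple_act G (inv\<^bsub>B4\<^esub> (braid_sigma 3)) (c, a, b) = (c, a, b \<otimes> a)"
    by (rule triple_act_inv; use assms in \<open>simp add: braid_sigma_closed triples_def s triple_gen_apply m_assoc inv_cancel_left\<close>)+
qed

lemma triple_act_b1:
  assumes "c \<in> carrier G" "a \<in> carrier G" "b \<in> carrier G"
  shows "triple_act G B.b1 (c, a, b) = (a \<otimes> c, a, b)"
  using assms by (simp add: B.b1_def triple_act_mult triple_act_simps triples_def m_assoc
    braid_sigma_closed)

lemma triple_act_b2:
  assumes "c \<in> carrier G" "a \<in> carrier G" "b \<in> carrier G"
  shows "triple_act G B.b2 (c, a, b) = (b \<otimes> c, a, b)"
  using assms by (simp add: B.b2_def triple_act_mult triple_act_simps triples_def m_assoc
    braid_sigma_closed inv_mult_group inv_cancel_left)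

text \<open>
  The first component evaluates a word in \<open>b\<^sub>1\<close> and \<open>b\<^sub>2\<close> at an arbitrary pair of elements of
  \<open>G\<close>, so an equation between braids becomes an equation that holds in every group.
\<close>

lemma triple_act_word:
  assumes "w \<in> gwords {1, 2}" "c \<in> carrier G" "a \<in> carrier G" "b \<in> carrier G"
  shows "triple_act G (word_value B4 (\<lambda>i::nat. if i = 1 then B.b1 else B.b2) w) (c, a, b) =
    (word_value G (\<lambda>i. if i = 1 then a else b) w \<otimes> c, a, b)"
  using assms(1)
proof (induction w)
  case Nil
  then show ?case using assms by (simp add: triple_act_one triples_def)
next
  case (Cons p w)
  let ?v = "word_value G (\<lambda>i. if i = 1 then a else b) w"
  let ?n = "word_value B4 (\<lambda>i::nat. if i = 1 then B.b1 else B.b2) w"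
  obtain i e where p: "p = (i, e)" by fastforce
  have w: "w \<in> gwords {1, 2}" using Cons.prems p by simp
  have v: "?v \<in> carrier G" "?n \<in> carrier B4"
    by (rule word_value_closed[OF _ w] B.word_value_closed[OF _ w]; use assms in simp)+
  have inv1: "triple_act G (inv\<^bsub>B4\<^esub> B.b1) (u, a, b) = (inv a \<otimes> u, a, b)"
    and inv2: "triple_act G (inv\<^bsub>B4\<^esub> B.b2) (u, a, b) = (inv b \<otimes> u, a, b)" if "u \<in> carrier G" for u
    by (rule triple_act_inv; use that assms in \<open>simp add: triples_def triple_act_b1 triple_act_b2 inv_cancel_left\<close>)+
  show ?case
    using Cons v assms by (auto simp: p triple_act_mult triples_def triple_act_b1 triple_act_b2 inv1 inv2 m_assoc)
qed

end

section \<open>The stabilizer of a line in the three-strand subgroup\<close>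

text \<open>
  In these matrices with nonnegative entries, an off-diagonal entry vanishes only if the letter that
  creates it does not occur. The factor \<open>e\<close> stands for a sign.
\<close>

lemma pos_act:
  assumes "p \<in> B.pos" "e \<noteq> 0"
  shows "\<exists>a b. triple_act integer_group p (c, 0, e) = (c, e * a, e * b) \<and>
      0 \<le> a \<and> 1 \<le> b \<and> (1 \<le> a \<or> p \<in> generate B4 {braid_sigma 3})"
    and "\<exists>a b. triple_act integer_group p (c, e, 0) = (c, e * a, e * b) \<and>
      1 \<le> a \<and> 0 \<le> b \<and> (1 \<le> b \<or> p \<in> generate B4 {braid_sigma 2})"
proof -
  interpret Z: group integer_group by simp
  have S: "s \<in> triples integer_group" for s by (cases s) (simp add: triples_def)
  note act = Z.triple_act_mult Z.triple_act_simps S B.pos_closed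
  show "\<exists>a b. triple_act integer_group p (c, 0, e) = (c, e * a, e * b) \<and>
      0 \<le> a \<and> 1 \<le> b \<and> (1 \<le> a \<or> p \<in> generate B4 {braid_sigma 3})"
    using assms(1)
  proof (induction rule: B.pos.induct)
    case one
    show ?case by (rule exI[of _ 0], rule exI[of _ 1]) (simp add: Z.triple_act_one S generate.one)
  next
    case (y p)
    then obtain a b where "triple_act integer_group p (c, 0, e) = (c, e * a, e * b)" "0 \<le> a" "1 \<le> b"
      by blast
    then show ?case using y.hyps
      by (intro exI[of _ "b + a"] exI[of _ b]) (simp add: act distrib_left)
  next
    case (z p)
    then obtain a b where "triple_act integer_group p (c, 0, e) = (c, e * a, e * b)" "0 \<le> a" "1 \<le> b"
      "1 \<le> a \<or> p \<in> generate B4 {braid_sigma 3}"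
      by blast
    then show ?case using z.hyps
      by (intro exI[of _ a] exI[of _ "b + a"])
        (auto simp: act distrib_left intro: generate.eng generate.inv)
  qed
  show "\<exists>a b. triple_act integer_group p (c, e, 0) = (c, e * a, e * b) \<and>
      1 \<le> a \<and> 0 \<le> b \<and> (1 \<le> b \<or> p \<in> generate B4 {braid_sigma 2})"
    using assms(1)
  proof (induction rule: B.pos.induct)
    case one
    show ?case by (rule exI[of _ 1], rule exI[of _ 0]) (simp add: Z.triple_act_one S generate.one)
  next
    case (y p)
    then obtain a b where "triple_act integer_group p (c, e, 0) = (c, e * a, e * b)" "1 \<le> a" "0 \<le> b"
      "1 \<le> b \<or> p \<in> generate B4 {braid_sigma 2}"
      by blast
    then show ?case using y.hyps
      by (intro exI[of _ "b + a"] exI[of _ b])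
        (auto simp: act distrib_left intro: generate.eng generate.incl)
  next
    case (z p)
    then obtain a b where "triple_act integer_group p (c, e, 0) = (c, e * a, e * b)" "1 \<le> a" "0 \<le> b"
      by blast
    then show ?case using z.hyps
      by (intro exI[of _ a] exI[of _ "b + a"]) (simp add: act distrib_left)
  qed
qed

lemma \<Delta>_act:
  "triple_act integer_group B.\<Delta> (c, a, b) = (c, b, - a)"
proof -
  interpret Z: group integer_group by simp
  have S: "s \<in> triples integer_group" for s by (cases s) (simp add: triples_def)
  show ?thesis by (simp add: B.\<Delta>_def Z.triple_act_mult Z.triple_act_simps S)
qed

lemma W_act:
  assumes "w \<in> B.W"
  shows "triple_act integer_group w (c, 0, b) \<in> {(c, 0, b), (c, 0, - b)}"
proof -
  interpret Z: group integer_group by simp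
  have S: "s \<in> triples integer_group" for s by (cases s) (simp add: triples_def)
  note act = Z.triple_act_mult Z.triple_act_simps S
  have D: "triple_act integer_group (B.\<Delta> \<otimes>\<^bsub>B4\<^esub> B.\<Delta>) (c, a, b) = (c, - a, - b)" for a b
    by (simp add: act \<Delta>_act)
  have iD: "triple_act integer_group (inv\<^bsub>B4\<^esub> (B.\<Delta> \<otimes>\<^bsub>B4\<^esub> B.\<Delta>)) (c, a, b) = (c, - a, - b)" for a b
    by (rule Z.triple_act_inv) (simp_all add: S D)
  from assms show ?thesis
  proof (induction arbitrary: b rule: generate.induct)
    case one
    show ?case by (simp add: Z.triple_act_one S)
  next
    case (incl h)
    then show ?case by (auto simp: D act)
  next
    case (inv h)
    then show ?case by (auto simp: iD act simp del: B.inv_mult_group)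
  next
    case (eng h1 h2)
    have "triple_act integer_group (h1 \<otimes>\<^bsub>B4\<^esub> h2) (c, 0, b) =
        triple_act integer_group h1 (triple_act integer_group h2 (c, 0, b))"
      using eng.hyps by (simp add: act B.W_closed)
    then show ?case using eng.IH(1)[of b] eng.IH(1)[of "- b"] eng.IH(2)[of b]
      by (elim insertE emptyE) simp_all
  qed
qed

lemma \<Delta>_conj_in_W:
  assumes "p \<in> generate B4 {braid_sigma 2}"
  shows "B.\<Delta> \<otimes>\<^bsub>B4\<^esub> p \<otimes>\<^bsub>B4\<^esub> B.\<Delta> \<in> B.W"
proof -
  let ?Y = "{p \<in> carrier B4. B.\<Delta> \<otimes>\<^bsub>B4\<^esub> p \<otimes>\<^bsub>B4\<^esub> B.\<Delta> \<in> B.W}"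
  have "generate B4 {braid_sigma 2} \<subseteq> ?Y"
  proof (rule B.generate_subset_of_left_closed)
    show "\<one>\<^bsub>B4\<^esub> \<in> ?Y" by (simp add: generate.incl)
  next
    fix k v assume "k \<in> {braid_sigma 2}" "v \<in> ?Y"
    then have k: "k = braid_sigma 2" and v: "v \<in> carrier B4" "B.\<Delta> \<otimes>\<^bsub>B4\<^esub> v \<otimes>\<^bsub>B4\<^esub> B.\<Delta> \<in> B.W" by auto
    have "B.\<Delta> \<otimes>\<^bsub>B4\<^esub> (k \<otimes>\<^bsub>B4\<^esub> v) \<otimes>\<^bsub>B4\<^esub> B.\<Delta> =
        (B.\<Delta> \<otimes>\<^bsub>B4\<^esub> k) \<otimes>\<^bsub>B4\<^esub> v \<otimes>\<^bsub>B4\<^esub> B.\<Delta>"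
      and "B.\<Delta> \<otimes>\<^bsub>B4\<^esub> (inv\<^bsub>B4\<^esub> k \<otimes>\<^bsub>B4\<^esub> v) \<otimes>\<^bsub>B4\<^esub> B.\<Delta> =
        (B.\<Delta> \<otimes>\<^bsub>B4\<^esub> inv\<^bsub>B4\<^esub> k) \<otimes>\<^bsub>B4\<^esub> v \<otimes>\<^bsub>B4\<^esub> B.\<Delta>"
      using v k by (simp_all add: B.m_assoc)
    then have "B.\<Delta> \<otimes>\<^bsub>B4\<^esub> (k \<otimes>\<^bsub>B4\<^esub> v) \<otimes>\<^bsub>B4\<^esub> B.\<Delta> =
        braid_sigma 3 \<otimes>\<^bsub>B4\<^esub> (B.\<Delta> \<otimes>\<^bsub>B4\<^esub> v \<otimes>\<^bsub>B4\<^esub> B.\<Delta>)"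
      and "B.\<Delta> \<otimes>\<^bsub>B4\<^esub> (inv\<^bsub>B4\<^esub> k \<otimes>\<^bsub>B4\<^esub> v) \<otimes>\<^bsub>B4\<^esub> B.\<Delta> =
        inv\<^bsub>B4\<^esub> (braid_sigma 3) \<otimes>\<^bsub>B4\<^esub> (B.\<Delta> \<otimes>\<^bsub>B4\<^esub> v \<otimes>\<^bsub>B4\<^esub> B.\<Delta>)"
      using v k by (simp_all add: B.\<Delta>_y B.\<Delta>_inv_y B.m_assoc)
    moreover have "braid_sigma 3 \<in> B.W" "inv\<^bsub>B4\<^esub> (braid_sigma 3) \<in> B.W"
      by (auto intro: generate.intros)
    ultimately show "k \<otimes>\<^bsub>B4\<^esub> v \<in> ?Y" "inv\<^bsub>B4\<^esub> k \<otimes>\<^bsub>B4\<^esub> v \<in> ?Y"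
      using v k by (auto intro: generate.eng)
  qed auto
  then show ?thesis using assms by blast
qed

text \<open>
  In the normal form \<open>e p d w\<close>, the factor \<open>w\<close> fixes the second coordinate vector up to sign, and
  \<open>\<Delta>\<close> exchanges the two coordinate lines. Positivity rules out exactly one \<open>\<Delta>\<close> among \<open>e\<close> and
  \<open>d\<close>, since the diagonal entries of \<open>p\<close> are at least \<open>1\<close>. In the other two cases an off-diagonal
  entry of \<open>p\<close> vanishes, so \<open>p\<close> is a power of one generator.
\<close>

lemma stabilizer_in_W:
  assumes h: "h \<in> generate B4 {braid_sigma 2, braid_sigma 3}"
    and stab: "fst (snd (triple_act integer_group h (0, 0, 1))) = 0"
  shows "h \<in> B.W"
proof -
  interpret Z: group integer_group by simp
  have S: "s \<in> triples integer_group" for s by (cases s) (simp add: triples_def)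
  from B.normal_form_H[OF h] obtain e p d w where
    w: "w \<in> B.W" and p: "p \<in> B.pos" and e: "e \<in> {\<one>\<^bsub>B4\<^esub>, B.\<Delta>}" and d: "d \<in> {\<one>\<^bsub>B4\<^esub>, B.\<Delta>}"
    and h_eq: "h = e \<otimes>\<^bsub>B4\<^esub> (p \<otimes>\<^bsub>B4\<^esub> (d \<otimes>\<^bsub>B4\<^esub> w))" by blast
  have cl: "w \<in> carrier B4" "p \<in> carrier B4" "e \<in> carrier B4" "d \<in> carrier B4"
    using w p e d B.W_closed B.pos_closed by auto
  obtain s where s: "s = 1 \<or> s = - 1" "triple_act integer_group w (0, 0, 1) = (0, 0, s)"
    using W_act[OF w, of 0 1] by auto
  have sub: "generate B4 {braid_sigma 3} \<subseteq> B.W"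
    by (rule B.mono_generate) auto
  have act: "triple_act integer_group h (0, 0, 1) =
      triple_act integer_group e (triple_act integer_group p (triple_act integer_group d (0, 0, s)))"
    using cl s by (simp add: h_eq Z.triple_act_mult S)
  have one: "triple_act integer_group \<one>\<^bsub>B4\<^esub> t = t" for t by (rule Z.triple_act_one[OF S])
  have s0: "s \<noteq> 0" using s by auto
  obtain a b where ab: "triple_act integer_group p (0, 0, s) = (0, s * a, s * b)"
    "0 \<le> a" "1 \<le> b" "1 \<le> a \<or> p \<in> generate B4 {braid_sigma 3}"
    using pos_act(1)[OF p s0] by blast
  obtain a' b' where ab': "triple_act integer_group p (0, s, 0) = (0, s * a', s * b')"
    "1 \<le> a'" "0 \<le> b'" "1 \<le> b' \<or> p \<in> generate B4 {braid_sigma 2}"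
    using pos_act(2)[OF p s0] by blast
  from e d consider "e = \<one>\<^bsub>B4\<^esub>" "d = \<one>\<^bsub>B4\<^esub>" | "e = B.\<Delta>" "d = \<one>\<^bsub>B4\<^esub>"
    | "e = \<one>\<^bsub>B4\<^esub>" "d = B.\<Delta>" | "e = B.\<Delta>" "d = B.\<Delta>" by blast
  then show ?thesis
  proof cases
    case 1
    then have "p \<in> generate B4 {braid_sigma 3}" using act stab ab s0 by (auto simp: one)
    then show ?thesis using 1 cl w sub by (auto simp: h_eq intro: generate.eng)
  next
    case 2
    then show ?thesis using act stab ab s0 by (auto simp: one \<Delta>_act)
  next
    case 3
    then show ?thesis using act stab ab' s0 by (auto simp: one \<Delta>_act)
  next
    case 4
    then have "p \<in> generate B4 {braid_sigma 2}" using act stab ab' s0 by (auto simp: \<Delta>_act)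
    then have "B.\<Delta> \<otimes>\<^bsub>B4\<^esub> p \<otimes>\<^bsub>B4\<^esub> B.\<Delta> \<otimes>\<^bsub>B4\<^esub> w \<in> B.W"
      by (rule generate.eng[OF \<Delta>_conj_in_W w])
    then show ?thesis using 4 cl by (simp add: h_eq B.m_assoc)
  qed
qed

section \<open>Words fixed by a transvection\<close>

definition mat2 :: "int \<Rightarrow> int \<Rightarrow> int \<Rightarrow> int \<Rightarrow> int ^ 2 ^ 2" where
  "mat2 p q r s = vector [vector [p, q], vector [r, s]]"

lemma mat2_mult [simp]:
  "mat2 p q r s ** mat2 p' q' r' s' =
    mat2 (p * p' + q * r') (p * q' + q * s') (r * p' + s * r') (r * q' + s * s')"
  by (simp add: mat2_def vec_eq_iff forall_2 matrix_matrix_mult_def sum_2)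

lemma mat2_one: "mat 1 = mat2 1 0 0 1"
  by (simp add: mat2_def vec_eq_iff forall_2 mat_def)

lemma mat2_apply [simp]:
  "(mat2 p q r s *v v) $ 1 = p * v $ 1 + q * v $ 2"
  "(mat2 p q r s *v v) $ 2 = r * v $ 1 + s * v $ 2"
  by (simp_all add: mat2_def matrix_vector_mult_def sum_2)

lemma mat2_invertible:
  assumes "p * s - q * r = 1"
  shows "invertible (mat2 p q r s)" "inv\<^bsub>GL\<^esub> (mat2 p q r s) = mat2 s (- q) (- r) p"
proof -
  have m: "mat2 p q r s ** mat2 s (- q) (- r) p = mat 1" "mat2 s (- q) (- r) p ** mat2 p q r s = mat 1"
    using assms by (simp_all add: mat2_one algebra_simps)
  then show "invertible (mat2 p q r s)" "inv\<^bsub>GL\<^esub> (mat2 p q r s) = mat2 s (- q) (- r) p"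
    unfolding invertible_def by (blast, rule inv_GL_eqI)
qed

text \<open>
  The entry is \<open>3\<close>, not \<open>2\<close>, in order that the inverses move the start vector \<open>(1, 1)\<close> strictly
  inside a region: for \<open>2\<close> they would send it to a vector with \<open>v\<^sub>1 = - v\<^sub>2\<close>.
\<close>

definition free_pair :: "nat \<Rightarrow> int ^ 2 ^ 2" where
  "free_pair i = (if i = 1 then mat2 1 3 0 1 else mat2 1 0 3 1)"

text \<open>
  For \<open>free_pair\<close>, with values \<open>a\<close> and \<open>b\<close>, this is the pair \<open>a\<close>, \<open>b a\<close>. A word evaluated at it
  is the image of the word under the transvection that fixes \<open>a\<close> and sends \<open>b\<close> to \<open>b a\<close>.
\<close>

definition twisted_pair :: "nat \<Rightarrow> int ^ 2 ^ 2" where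
  "twisted_pair i = (if i = 1 then mat2 1 3 0 1 else mat2 1 0 3 1 ** mat2 1 3 0 1)"

lemma pairs_closed: "free_pair \<in> X \<rightarrow> carrier GL" "twisted_pair \<in> X \<rightarrow> carrier GL"
  by (auto simp: free_pair_def twisted_pair_def mat2_invertible(1))

text \<open>
  In terms of the ratio \<open>r = v\<^sub>1 / v\<^sub>2\<close>, on which \<open>a\<close> acts as \<open>r \<mapsto> r + 3\<close> and \<open>b\<close> adds \<open>3\<close> to
  \<open>1 / r\<close>, the regions of \<open>a, a\<inverse>, b, b\<inverse>\<close> are \<open>r > 1\<close>, \<open>r < - 1\<close>, \<open>0 < r < 1\<close> and
  \<open>- 1 < r < 0\<close>. The start vector with \<open>r = 1\<close> lies in none of them.
\<close>

definition free_region :: "nat \<times> bool \<Rightarrow> (int ^ 2) set" where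
  "free_region q = {v. if fst q = 1 then
      (if snd q then (0 < v$2 \<and> v$2 < v$1) \<or> (v$1 < v$2 \<and> v$2 < 0)
       else (0 < v$2 \<and> v$1 < - v$2) \<or> (v$2 < 0 \<and> - v$2 < v$1))
    else
      (if snd q then (0 < v$1 \<and> v$1 < v$2) \<or> (v$2 < v$1 \<and> v$1 < 0)
       else (0 < v$1 \<and> v$2 < - v$1) \<or> (v$1 < 0 \<and> - v$1 < v$2))}"

text \<open>
  Regions for the letters \<open>a\<close> and \<open>d = b a\<close>, obtained from the reduced form in \<open>a\<close> and \<open>b\<close> of a
  reduced word in \<open>a\<close> and \<open>d\<close>. Such a word starts with \<open>b\<close> if its first letter is \<open>d\<close>, and with
  \<open>a\<inverse> b\<inverse>\<close> if it is \<open>d\<inverse>\<close>; after a first letter \<open>a\<close> the cancellation in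
  \<open>a d\<inverse> = b\<inverse>\<close> is possible, and a first letter \<open>a\<inverse>\<close> is never followed by \<open>b\<inverse>\<close>. The
  region \<open>a\<inverse> b\<inverse>\<close> consists of the ratios between \<open>- 4\<close> and \<open>- 3\<close>.
\<close>

definition twisted_region :: "nat \<times> bool \<Rightarrow> (int ^ 2) set" where
  "twisted_region q = (if q = (1, True) then free_region (1, True) \<union> free_region (2, False)
    else if q = (1, False) then {v. 
      (0 < v$2 \<and> (v$1 < - 4 * v$2 \<or> - 3 * v$2 < v$1 \<and> v$1 < - v$2)) \<or>
      (v$2 < 0 \<and> (- 4 * v$2 < v$1 \<or> - v$2 < v$1 \<and> v$1 < - 3 * v$2))}
    else if q = (2, True) then free_region (2, True)
    else {v. (0 < v$2 \<and> - 4 * v$2 < v$1 \<and> v$1 < - 3 * v$2) \<or>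
      (v$2 < 0 \<and> - 3 * v$2 < v$1 \<and> v$1 < - 4 * v$2)})"

abbreviation "vec11 \<equiv> (vector [1, 1] :: int ^ 2)"

lemma ping_pong_free_pair:
  assumes "w \<in> gwords {1, 2}" "reduced_word w" "w \<noteq> []"
  shows "word_value GL free_pair w *v vec11 \<in> free_region (hd w)"
proof (rule ping_pong[where V = "{vec11}" and X = "{1, 2}", OF pairs_closed(1) _ _ assms])
  fix x :: nat and b v assume "x \<in> {1, 2}" "v \<in> {vec11}"
  then show "(if b then free_pair x else inv\<^bsub>GL\<^esub> (free_pair x)) *v v \<in> free_region (x, b)"
    by (auto simp: free_pair_def free_region_def mat2_invertible)
next
  fix x :: nat and b q v assume "x \<in> {1, 2}" "fst q \<in> {1, 2}" "q \<noteq> (x, \<not> b)" "v \<in> free_region q"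
  then show "(if b then free_pair x else inv\<^bsub>GL\<^esub> (free_pair x)) *v v \<in> free_region (x, b)"
    by (cases q) (auto simp: free_pair_def free_region_def mat2_invertible split: if_splits)
qed simp

lemma ping_pong_twisted_pair:
  assumes "w \<in> gwords {1, 2}" "reduced_word w" "w \<noteq> []"
  shows "word_value GL twisted_pair w *v vec11 \<in> twisted_region (hd w)"
proof (rule ping_pong[where V = "{vec11}" and X = "{1, 2}", OF pairs_closed(2) _ _ assms])
  fix x :: nat and b v assume "x \<in> {1, 2}" "v \<in> {vec11}"
  then show "(if b then twisted_pair x else inv\<^bsub>GL\<^esub> (twisted_pair x)) *v v \<in> twisted_region (x, b)"
    by (auto simp: twisted_pair_def free_region_def twisted_region_def mat2_invertible)
next
  fix x :: nat and b q v assume x: "x \<in> {1, 2}" "fst q \<in> {1, 2}" and q: "q \<noteq> (x, \<not> b)" "v \<in> twisted_region q"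
  have "q \<in> {(1, True), (1, False), (2, True), (2, False)}" using x by (cases q) auto
  then show "(if b then twisted_pair x else inv\<^bsub>GL\<^esub> (twisted_pair x)) *v v \<in> twisted_region (x, b)"
    using x(1) q
    by (elim insertE emptyE; cases b;
      simp add: twisted_pair_def free_region_def twisted_region_def mat2_invertible; (arith)?)
qed simp

lemma GL_left_cancel:
  fixes A B C :: "'a::comm_ring_1 ^ 'n ^ 'n"
  assumes "invertible A" "A ** B = A ** C"
  shows "B = C"
proof -
  obtain A' where "A' ** A = mat 1" using assms(1) by (auto simp: invertible_def)
  then show ?thesis using arg_cong[OF assms(2), of "(**) A'"]
    by (simp add: matrix_mul_assoc)
qed

abbreviation "b_gen \<equiv> (\<lambda>i::nat. if i = 1 then B.b1 else B.b2)"

lemma b_gen_closed: "b_gen \<in> X \<rightarrow> carrier B4"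
  by simp

lemma N_word_values: "B.N = word_value B4 b_gen ` gwords {1, 2}"
proof -
  have "b_gen ` {1, 2} = {B.b1, B.b2}" by auto
  then show ?thesis using B.generate_eq_word_values[OF b_gen_closed, of "{1, 2}"] by (simp only:)
qed

text \<open>
  Let \<open>w'\<close> denote \<open>w\<close> with \<open>b\<close> replaced by \<open>b a\<close>. Reading \<open>w\<close> from the left, the equation
  \<open>w = w'\<close> turns into \<open>u = a u'\<close> for the remaining word \<open>u\<close> after a letter \<open>b\<close>, and back after a
  letter \<open>b\<inverse>\<close>, while letters \<open>a\<^sup>i\<close> leave either equation unchanged. The letters read between
  such a \<open>b\<close> and \<open>b\<inverse>\<close> contribute powers of \<open>b a b\<inverse>\<close>. A letter \<open>b\<inverse>\<close> in the first
  situation or \<open>b\<close> in the second is impossible, because by ping-pong the two sides would move the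
  start vector to disjoint regions; the word cannot end in the second situation because \<open>a \<noteq> 1\<close>.
\<close>

lemma twisted_fixed_words:
  assumes "w \<in> gwords {1, 2}" "reduced_word w"
  shows "(word_value GL free_pair w = word_value GL twisted_pair w \<longrightarrow> word_value B4 b_gen w \<in> generate B4 {B.b1, B.c}) \<and>
    (word_value GL free_pair w = mat2 1 3 0 1 ** word_value GL twisted_pair w \<longrightarrow>
      B.b2 \<otimes>\<^bsub>B4\<^esub> word_value B4 b_gen w \<in> generate B4 {B.b1, B.c})"
  using assms
proof (induction w)
  case Nil
  have "mat 1 \<noteq> mat2 1 3 0 1"
  proof
    assume "mat 1 = mat2 1 3 0 1"
    then have "(mat 1 *v vec11) $ 1 = (mat2 1 3 0 1 *v vec11) $ 1" by simp
    then show False by simp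
  qed
  then show ?case by (simp add: generate.one group.word_value_Nil[OF group_GL])
next
  case (Cons p w)
  let ?F = "generate B4 {B.b1, B.c}" and ?v = "word_value B4 b_gen w"
  let ?A = "word_value GL free_pair" and ?B = "word_value GL twisted_pair" and ?a = "mat2 1 3 0 1"
  obtain i e where p: "p = (i, e)" by fastforce
  have w: "w \<in> gwords {1, 2}" "reduced_word w" and i: "i = 1 \<or> i = 2"
    using Cons.prems p by (auto simp: reduced_word_Cons)
  have v: "?v \<in> carrier B4" by (rule B.word_value_closed[OF b_gen_closed w(1)])
  have IH0: "?v \<in> ?F" if "?A w = ?B w" using Cons.IH[OF w] that by blast
  have IH1: "B.b2 \<otimes>\<^bsub>B4\<^esub> ?v \<in> ?F" if "?A w = ?a ** ?B w" using Cons.IH[OF w] that by blast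
  have b1F: "B.b1 \<in> ?F" "inv\<^bsub>B4\<^esub> B.b1 \<in> ?F" and cF: "B.c \<in> ?F" "inv\<^bsub>B4\<^esub> B.c \<in> ?F"
    by (auto intro: generate.intros)
  note wv = group.word_value_Cons[OF group_GL] p
  note inv = mat2_invertible
  from i consider "i = 1" | "i = 2" "e" | "i = 2" "\<not> e" by blast
  then show ?case
  proof cases
    case 1
    let ?L = "if e then ?a else mat2 1 (- 3) 0 1"
    have L: "invertible ?L" by (simp add: inv)
    have A: "?A (p # w) = ?L ** ?A w" "?B (p # w) = ?L ** ?B w"
      using 1 by (simp_all add: wv free_pair_def twisted_pair_def inv)
    have comm: "?a ** (?L ** M) = ?L ** (?a ** M)" for M :: "int ^ 2 ^ 2"
      by (simp add: matrix_mul_assoc)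
    show ?thesis
    proof (intro conjI impI)
      assume "?A (p # w) = ?B (p # w)"
      then have "?A w = ?B w" unfolding A by (rule GL_left_cancel[OF L])
      from IH0[OF this] show "word_value B4 b_gen (p # w) \<in> ?F"
        using b1F 1 by (auto simp: p intro: generate.eng)
    next
      assume "?A (p # w) = ?a ** ?B (p # w)"
      then have "?A w = ?a ** ?B w" unfolding A comm by (rule GL_left_cancel[OF L])
      note IH = IH1[OF this]
      have "B.b2 \<otimes>\<^bsub>B4\<^esub> word_value B4 b_gen (p # w) =
          (if e then B.c else inv\<^bsub>B4\<^esub> B.c) \<otimes>\<^bsub>B4\<^esub> (B.b2 \<otimes>\<^bsub>B4\<^esub> ?v)"
        using 1 v by (simp add: p B.c_def B.cancel_simps B.inv_mult_group)
      then show "B.b2 \<otimes>\<^bsub>B4\<^esub> word_value B4 b_gen (p # w) \<in> ?F"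
        using generate.eng[OF _ IH] cF by simp
    qed
  next
    case 2
    let ?L = "mat2 1 0 3 1"
    have L: "invertible ?L" by (simp add: inv)
    have A: "?A (p # w) = ?L ** ?A w" "?B (p # w) = ?L ** (?a ** ?B w)"
      using 2 by (simp_all add: wv free_pair_def twisted_pair_def matrix_mul_assoc)
    show ?thesis
    proof (intro conjI impI)
      assume "?A (p # w) = ?B (p # w)"
      then have "?A w = ?a ** ?B w" unfolding A by (rule GL_left_cancel[OF L])
      from IH1[OF this] show "word_value B4 b_gen (p # w) \<in> ?F"
        using 2 by (simp add: p)
    next
      assume eq: "?A (p # w) = ?a ** ?B (p # w)"
      have "?A (p # w) *v vec11 \<in> free_region (2, True)" "?B (p # w) *v vec11 \<in> twisted_region (2, True)"
        using ping_pong_free_pair[OF Cons.prems] ping_pong_twisted_pair[OF Cons.prems] 2 p by simp_all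
      then have False unfolding eq matrix_vector_mul_assoc[symmetric]
        by (auto simp: free_region_def twisted_region_def)
      then show "B.b2 \<otimes>\<^bsub>B4\<^esub> word_value B4 b_gen (p # w) \<in> ?F" ..
    qed
  next
    case 3
    let ?L = "mat2 1 0 (- 3) 1"
    have L: "invertible ?L" by (simp add: inv)
    have A: "?A (p # w) = ?L ** ?A w" "?a ** ?B (p # w) = ?L ** ?B w"
      using 3 by (simp_all add: wv free_pair_def twisted_pair_def inv matrix_mul_assoc)
    show ?thesis
    proof (intro conjI impI)
      assume eq: "?A (p # w) = ?B (p # w)"
      have "?A (p # w) *v vec11 \<in> free_region (2, False)" "?B (p # w) *v vec11 \<in> twisted_region (2, False)"
        using ping_pong_free_pair[OF Cons.prems] ping_pong_twisted_pair[OF Cons.prems] 3 p by simp_all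
      then have False unfolding eq by (auto simp: free_region_def twisted_region_def)
      then show "word_value B4 b_gen (p # w) \<in> ?F" ..
    next
      assume "?A (p # w) = ?a ** ?B (p # w)"
      then have "?A w = ?B w" unfolding A by (rule GL_left_cancel[OF L])
      from IH0[OF this] show "B.b2 \<otimes>\<^bsub>B4\<^esub> word_value B4 b_gen (p # w) \<in> ?F"
        using 3 v by (simp add: p B.cancel_simps)
    qed
  qed
qed

section \<open>The centralizer\<close>

text \<open>
  Applied to the triple \<open>(1, a, b)\<close>, the two orders of the product of \<open>n\<close> and \<open>\<sigma>\<^sub>3\<inverse>\<close> have
  the first components \<open>w(a, b a)\<close> and \<open>w(a, b)\<close>.
\<close>

lemma N_commuting_with_sigma3:
  assumes n: "n \<in> B.N" and comm: "n \<otimes>\<^bsub>B4\<^esub> braid_sigma 3 = braid_sigma 3 \<otimes>\<^bsub>B4\<^esub> n"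
  shows "n \<in> generate B4 {B.b1, B.c}"
proof -
  interpret GL2: group "GL :: (int ^ 2 ^ 2) monoid" by (rule group_GL)
  obtain u where u: "u \<in> gwords {1, 2}" "n = word_value B4 b_gen u"
    using n N_word_values by auto
  obtain w where w: "w \<in> gwords {1, 2}" "reduced_word w" "(u, w) \<in> pres_rel {1, 2} {}"
    using exists_reduced_word[OF u(1)] by blast
  have nw: "n = word_value B4 b_gen w"
    unfolding u(2) by (rule B.word_value_pres_rel[OF b_gen_closed _ w(3)]) simp
  let ?a = "mat2 1 3 0 1" and ?b = "mat2 1 0 3 1"
  have ab: "?a \<in> carrier GL" "?b \<in> carrier GL" "?b ** ?a \<in> carrier GL" "mat 1 \<in> carrier (GL :: (int ^ 2 ^ 2) monoid)"
    by (simp_all add: mat2_invertible mat2_one)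
  have free_pair: "(\<lambda>i. if i = 1 then ?a else ?b) = free_pair" and twisted_pair: "(\<lambda>i. if i = 1 then ?a else ?b ** ?a) = twisted_pair"
    by (simp_all add: fun_eq_iff free_pair_def twisted_pair_def)
  have wc: "word_value GL free_pair w \<in> carrier GL"
    by (rule GL2.word_value_closed[OF pairs_closed(1) w(1)])
  have S: "(M, ?a, ?b) \<in> triples GL" if "M \<in> carrier GL" for M
    using ab that by (simp add: triples_def)
  have nc: "n \<in> carrier B4" by (rule B.N_closed[OF n])
  let ?z = "inv\<^bsub>B4\<^esub> (braid_sigma 3)"
  have comm': "n \<otimes>\<^bsub>B4\<^esub> ?z = ?z \<otimes>\<^bsub>B4\<^esub> n"
    using B.commutes_inv[of "braid_sigma 3" n] comm nc by simp
  have "triple_act GL (n \<otimes>\<^bsub>B4\<^esub> ?z) (mat 1, ?a, ?b) = triple_act GL n (mat 1, ?a, ?b ** ?a)"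
    using GL2.triple_act_mult[OF nc _ S[OF ab(4)], of ?z] GL2.triple_act_simps(6)[OF ab(4) ab(1,2)] by simp
  also have "\<dots> = (word_value GL twisted_pair w, ?a, ?b ** ?a)"
    using GL2.triple_act_word[OF w(1) ab(4) ab(1) ab(3)] unfolding nw twisted_pair by simp
  finally have 1: "triple_act GL (n \<otimes>\<^bsub>B4\<^esub> ?z) (mat 1, ?a, ?b) = (word_value GL twisted_pair w, ?a, ?b ** ?a)" .
  have "triple_act GL (?z \<otimes>\<^bsub>B4\<^esub> n) (mat 1, ?a, ?b) = triple_act GL ?z (word_value GL free_pair w, ?a, ?b)"
    using GL2.triple_act_mult[OF _ nc S[OF ab(4)], of ?z] GL2.triple_act_word[OF w(1) ab(4) ab(1) ab(2)]
    unfolding nw free_pair by simp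
  also have "\<dots> = (word_value GL free_pair w, ?a, ?b ** ?a)"
    using GL2.triple_act_simps(6)[OF wc ab(1,2)] by simp
  finally have "word_value GL free_pair w = word_value GL twisted_pair w"
    using 1 unfolding comm' by simp
  then show ?thesis using twisted_fixed_words[OF w(1,2)] nw by simp
qed

text \<open>
  In the action for \<open>G = \<int>\<close>, the vector \<open>(0, 1)\<close> is fixed by \<open>\<sigma>\<^sub>3\<close>, hence its image under an
  element of the centralizer is fixed as well and lies on the same line. The part of the element in
  \<open>N\<close> does not act on the vector, so the other part stabilizes this line.
\<close>

theorem centralizer_factorization:
  assumes g: "g \<in> centralizer B4 (braid_sigma 3)"
  shows "\<exists>f\<in>generate B4 {B.b1, B.c}. \<exists>k\<in>generate B4 {braid_sigma 3, B.\<xi>}. g = f \<otimes>\<^bsub>B4\<^esub> k"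
proof -
  interpret Z: group integer_group by simp
  let ?z = "braid_sigma 3" and ?act = "triple_act integer_group"
  have S: "s \<in> triples integer_group" for s by (cases s) (simp add: triples_def)
  have gc: "g \<in> carrier B4" and comm: "g \<otimes>\<^bsub>B4\<^esub> ?z = ?z \<otimes>\<^bsub>B4\<^esub> g"
    using g by (auto simp: centralizer_def)
  obtain n h where n: "n \<in> B.N" and h: "h \<in> generate B4 {braid_sigma 2, ?z}" and gnh: "g = n \<otimes>\<^bsub>B4\<^esub> h"
    using B.factor_N_H[of g] gc carrier_B4 by auto
  have hc: "h \<in> carrier B4" using B.generate_in_carrier[OF _ h] by simp
  have nc: "n \<in> carrier B4" by (rule B.N_closed[OF n])
  have "?act g (0, 0, 1) = ?act (g \<otimes>\<^bsub>B4\<^esub> ?z) (0, 0, 1)"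
    using gc by (simp add: Z.triple_act_mult Z.triple_act_simps S)
  also have "\<dots> = ?act ?z (?act g (0, 0, 1))"
    using gc by (simp add: comm Z.triple_act_mult S)
  finally have fixed: "?act ?z (?act g (0, 0, 1)) = ?act g (0, 0, 1)" by simp
  have g0: "fst (snd (?act g (0, 0, 1))) = 0"
  proof (cases "?act g (0, 0, 1)")
    case (fields r s t)
    then show ?thesis using fixed by (simp add: Z.triple_act_simps)
  qed
  have "fst (snd (?act n s)) = fst (snd s)" for s
  proof (cases s)
    case (fields r a b)
    obtain u where u: "u \<in> gwords {1, 2}" "n = word_value B4 b_gen u"
      using n N_word_values by auto
    show ?thesis using Z.triple_act_word[OF u(1), of r a b] by (simp add: fields u(2))
  qed
  then have "fst (snd (?act h (0, 0, 1))) = 0"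
    using g0 nc hc by (simp add: gnh Z.triple_act_mult S)
  then have "h \<in> B.W" by (rule stabilizer_in_W[OF h])
  then obtain f k where f: "f \<in> B.N" and k: "k \<in> generate B4 {?z, B.\<xi>}" and gfk: "g = f \<otimes>\<^bsub>B4\<^esub> k"
    using B.factor_N_W[OF n] gnh by blast
  have fc: "f \<in> carrier B4" by (rule B.N_closed[OF f])
  have kc: "k \<in> carrier B4" using B.generate_in_carrier[OF _ k] by simp
  have kz: "k \<otimes>\<^bsub>B4\<^esub> ?z = ?z \<otimes>\<^bsub>B4\<^esub> k"
    by (rule B.commutes_generate[OF _ _ _ k]) (use B.z_\<xi> in auto)
  have "f \<otimes>\<^bsub>B4\<^esub> ?z \<otimes>\<^bsub>B4\<^esub> k = ?z \<otimes>\<^bsub>B4\<^esub> f \<otimes>\<^bsub>B4\<^esub> k"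
    using comm fc kc by (simp add: gfk B.m_assoc kz)
  then have "f \<otimes>\<^bsub>B4\<^esub> ?z = ?z \<otimes>\<^bsub>B4\<^esub> f"
    using fc kc by (subst (asm) B.right_cancel) simp_all
  then have "f \<in> generate B4 {B.b1, B.c}" by (rule N_commuting_with_sigma3[OF f])
  then show ?thesis using k gfk by blast
qed

section \<open>Leading terms of Laurent polynomials\<close>

definition tinv :: "'a::comm_ring_1 laurent" where
  "tinv = Poly_Mapping.single (- 1) 1"

lemma tvar_tinv [simp]: "tvar * tinv = 1" "tinv * tvar = 1"
  by (simp_all add: tvar_def tinv_def mult_single single_one)

lemma tvar_tinv_left [simp]: "tvar * (tinv * p) = p" "tinv * (tvar * p) = p"
  by (simp_all flip: mult.assoc)

lemma lookup_single_mult: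
  fixes p :: "'a::comm_ring_1 laurent"
  shows "Poly_Mapping.lookup (Poly_Mapping.single k a * p) m = a * Poly_Mapping.lookup p (m - k)"
  by (induction p rule: laurent_induct)
    (auto simp: mult_single lookup_single distrib_left lookup_add when_def)

lemma lookup_shift [simp]:
  "Poly_Mapping.lookup (tvar * p) m = Poly_Mapping.lookup p (m - 1)"
  "Poly_Mapping.lookup (tinv * p) m = Poly_Mapping.lookup p (m + 1)"
  by (simp_all add: tvar_def tinv_def lookup_single_mult)

text \<open>
  The coefficient \<open>a\<close> may be \<open>0\<close>; then the statement is that the \<open>t\<close>-adic valuation of \<open>p\<close>
  exceeds \<open>n\<close>.
\<close>

definition lead :: "'a::comm_ring_1 laurent \<Rightarrow> int \<Rightarrow> 'a \<Rightarrow> bool" where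
  "lead p n a \<longleftrightarrow> Poly_Mapping.lookup p n = a \<and> (\<forall>m<n. Poly_Mapping.lookup p m = 0)"

lemma single_eq_1: "Poly_Mapping.single k (1::'a::comm_ring_1) = 1 \<Longrightarrow> k = (0::int)"
  by (metis lookup_single_eq lookup_single_not_eq single_one zero_neq_one)

section \<open>Burau matrices\<close>

definition mat3 :: "'a \<Rightarrow> 'a \<Rightarrow> 'a \<Rightarrow> 'a \<Rightarrow> 'a \<Rightarrow> 'a \<Rightarrow> 'a \<Rightarrow> 'a \<Rightarrow> 'a \<Rightarrow> 'a::comm_ring_1 ^ 3 ^ 3" where
  "mat3 a b c d e f g h i = vector [vector [a, b, c], vector [d, e, f], vector [g, h, i]]"

lemma mat3_mult [simp]:
  "mat3 a b c d e f g h i ** mat3 a' b' c' d' e' f' g' h' i' =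
    mat3 (a * a' + b * d' + c * g') (a * b' + b * e' + c * h') (a * c' + b * f' + c * i')
      (d * a' + e * d' + f * g') (d * b' + e * e' + f * h') (d * c' + e * f' + f * i')
      (g * a' + h * d' + i * g') (g * b' + h * e' + i * h') (g * c' + h * f' + i * i')"
  by (simp add: mat3_def vec_eq_iff forall_3 matrix_matrix_mult_def sum_3)

lemma mat3_one: "mat 1 = mat3 1 0 0 0 1 0 0 0 1"
  by (simp add: mat3_def vec_eq_iff forall_3 mat_def)

lemma mat3_apply [simp]:
  "(mat3 a b c d e f g h i *v v) $ 1 = a * v $ 1 + b * v $ 2 + c * v $ 3"
  "(mat3 a b c d e f g h i *v v) $ 2 = d * v $ 1 + e * v $ 2 + f * v $ 3"
  "(mat3 a b c d e f g h i *v v) $ 3 = g * v $ 1 + h * v $ 2 + i * v $ 3"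
  by (simp_all add: mat3_def matrix_vector_mult_def sum_3)

lemma mat3_eqI:
  "\<lbrakk>a = a'; b = b'; c = c'; d = d'; e = e'; f = f'; g = g'; h = h'; i = i'\<rbrakk> \<Longrightarrow>
    mat3 a b c d e f g h i = mat3 a' b' c' d' e' f' g' h' i'"
  by simp

definition burau_red :: "nat gword set \<Rightarrow> 'b::comm_ring_1 laurent ^ 3 ^ 3" where
  "burau_red = reduce_mat \<circ> burau4"

lemma burau_red_hom: "burau_red \<in> hom B4 GL"
  unfolding burau_red_def by (rule hom_compose[OF burau4_hom reduce_mat_hom])

lemma burau_red_mult:
  "g \<in> carrier B4 \<Longrightarrow> h \<in> carrier B4 \<Longrightarrow> burau_red (g \<otimes>\<^bsub>B4\<^esub> h) = burau_red g ** burau_red h"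
  using hom_mult[OF burau_red_hom] by simp

lemma burau_red_one: "burau_red \<one>\<^bsub>B4\<^esub> = mat 1"
  using hom_one[OF burau_red_hom group_braid_group group_GL] by simp

lemma burau_red_inv:
  "g \<in> carrier B4 \<Longrightarrow> burau_red (inv\<^bsub>B4\<^esub> g) = inv\<^bsub>GL\<^esub> (burau_red g)"
  by (rule group_hom.hom_inv[OF group_hom.intro[OF group_braid_group group_GL group_hom_axioms.intro[OF burau_red_hom]]])

lemma burau_red_invertible: "g \<in> carrier B4 \<Longrightarrow> invertible (burau_red g)"
  using hom_in_carrier[OF burau_red_hom] by simp

lemma reduce_tvar: "reduce tvar = tvar" "reduce (- tvar) = - tvar"
  by (rule poly_mapping_eqI; simp add: lookup_reduce tvar_def lookup_single when_def)+

lemma burau_red_sigma: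
  "burau_red (braid_sigma 1) = mat3 (- tvar) 1 0 0 1 0 0 0 1"
  "burau_red (braid_sigma 2) = mat3 1 0 0 tvar (- tvar) 1 0 0 1"
  "burau_red (braid_sigma 3) = mat3 1 0 0 0 1 0 0 tvar (- tvar)"
  by (simp_all add: burau_red_def burau4_braid_sigma burau_gen_def reduce_mat_def mat3_def
      vec_eq_iff forall_3 reduce_tvar reduce_0 reduce_1)

lemma mat3_inverse_sigma:
  "inv\<^bsub>GL\<^esub> (mat3 (- tvar) 1 0 0 1 0 0 0 1) = mat3 (- tinv) tinv 0 0 1 0 0 0 1"
  "inv\<^bsub>GL\<^esub> (mat3 1 0 0 tvar (- tvar) 1 0 0 1) = mat3 1 0 0 1 (- tinv) tinv 0 0 1"
  "inv\<^bsub>GL\<^esub> (mat3 1 0 0 0 1 0 0 tvar (- tvar)) = mat3 1 0 0 0 1 0 0 1 (- tinv)"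
  by (rule inv_GL_eqI; simp add: mat3_one)+

lemma burau_red_b1: "burau_red B.b1 = mat3 (- tvar) 1 0 0 1 0 0 1 (- tinv)"
  by (simp add: B.b1_def burau_red_mult burau_red_inv burau_red_sigma mat3_inverse_sigma)

lemma burau_red_b1_inv:
  "inv\<^bsub>GL\<^esub> (burau_red B.b1) = mat3 (- tinv) tinv 0 0 1 0 0 tvar (- tvar)"
  unfolding burau_red_b1 by (rule inv_GL_eqI) (simp_all add: mat3_one)

lemma burau_red_b2:
  "burau_red B.b2 = mat3 0 0 (- tvar) 0 (- tinv) (tinv - tvar) (- 1) 0 (1 - tvar)"
  by (simp add: B.b2_def burau_red_mult burau_red_inv burau_red_sigma mat3_inverse_sigma)

lemma GL_right_cancel:
  fixes A B C :: "'a::comm_ring_1 ^ 'n ^ 'n"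
  assumes "invertible A" "B ** A = C ** A"
  shows "B = C"
proof -
  obtain A' where "A ** A' = mat 1" using assms(1) by (auto simp: invertible_def)
  then show ?thesis using arg_cong[OF assms(2), of "\<lambda>M. M ** A'"]
    by (simp flip: matrix_mul_assoc)
qed

text \<open>
  Verifying \<open>M b\<^sub>2 = b\<^sub>2 b\<^sub>1\<close> for the claimed matrix \<open>M\<close> avoids the inverse of the matrix of \<open>b\<^sub>2\<close>.
\<close>

lemma burau_red_c:
  "burau_red B.c = mat3 (1 - tinv - tvar * tvar) (tvar * tvar) 0
    (tinv * tinv * tinv - tinv + 1 - tvar * tvar) (tvar * tvar) 0
    (tinv * tinv - tinv + tvar - tvar * tvar) (tvar * tvar) (- tvar)" (is "_ = ?M")
proof -
  have "burau_red B.c ** burau_red B.b2 = burau_red (B.b2 \<otimes>\<^bsub>B4\<^esub> B.b1)"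
    by (simp add: B.c_def B.m_assoc flip: burau_red_mult)
  also have "\<dots> = burau_red B.b2 ** burau_red B.b1" by (simp add: burau_red_mult)
  also have "\<dots> = ?M ** burau_red B.b2"
    unfolding burau_red_b1 burau_red_b2 mat3_mult by (rule mat3_eqI; simp add: algebra_simps)
  finally show ?thesis by (rule GL_right_cancel[OF burau_red_invertible, rotated]) simp
qed

lemma burau_red_c_inv:
  "inv\<^bsub>GL\<^esub> (burau_red B.c) = mat3 (- (tvar * tvar * tvar)) (tvar * tvar * tvar) 0
    (tinv * tinv - 1 + tvar - tvar * tvar * tvar) (1 - tvar + tvar * tvar * tvar) 0
    (tinv - 1 + tvar * tvar - tvar * tvar * tvar) (1 - tvar * tvar + tvar * tvar * tvar) (- tinv)"
  unfolding burau_red_c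
  by (rule inv_GL_eqI; unfold mat3_mult mat3_one; rule mat3_eqI; simp add: algebra_simps)

lemma burau_red_\<xi>:
  "burau_red B.\<xi> = mat3 (- (tvar * tvar * tvar)) (tvar * tvar * tvar) 0
    (tvar - tvar * tvar * tvar) (tvar * tvar * tvar) 0
    (tvar * tvar - tvar * tvar * tvar) (tvar * tvar * tvar) (- (tvar * tvar))"
  by (simp add: B.\<xi>_def B.\<Delta>_def burau_red_mult burau_red_b1 burau_red_sigma)
    (rule mat3_eqI; simp add: algebra_simps)

lemma burau_red_\<xi>_inv:
  "inv\<^bsub>GL\<^esub> (burau_red B.\<xi>) = mat3 (- tinv) tinv 0
    (tinv * tinv * tinv - tinv) tinv 0
    (tinv * tinv - tinv) tinv (- (tinv * tinv))"
  unfolding burau_red_\<xi>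
  by (rule inv_GL_eqI; unfold mat3_mult mat3_one; rule mat3_eqI; simp add: algebra_simps)

lemma burau_red_\<xi>2:
  fixes v :: "'b::comm_ring_1 laurent ^ 3"
  shows "burau_red (B.\<xi> \<otimes>\<^bsub>B4\<^esub> B.\<xi>) *v v = Poly_Mapping.single 4 1 *s v"
proof -
  have t4: "Poly_Mapping.single 4 1 = (tvar * tvar * tvar * tvar :: 'b laurent)"
    by (simp add: tvar_def mult_single)
  have "burau_red B.\<xi> ** burau_red B.\<xi> = mat3 (tvar * tvar * tvar * tvar) 0 0 0 (tvar * tvar * tvar * tvar) 0 0 0 (tvar * tvar * tvar * tvar :: 'b laurent)"
    unfolding burau_red_\<xi> mat3_mult by (rule mat3_eqI; simp add: algebra_simps)
  note eq = this
  show ?thesis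
    unfolding burau_red_mult[OF B.closed(5) B.closed(5)] eq
    by (simp add: vec_eq_iff forall_3 t4)
qed

section \<open>Ping-pong for the Burau matrices\<close>

definition burau_pair :: "nat \<Rightarrow> 'b::comm_ring_1 laurent ^ 3 ^ 3" where
  "burau_pair i = burau_red (if i = 1 then B.b1 else B.c)"

text \<open>
  The vectors for which \<open>v\<^sub>1 / v\<^sub>2\<close> has valuation \<open>1\<close>.
\<close>

definition burau_base :: "('b::comm_ring_1 laurent ^ 3) set" where
  "burau_base = {v. \<exists>n a b. a \<noteq> 0 \<and> b \<noteq> 0 \<and> lead (v $ 1) (n + 1) a \<and> lead (v $ 2) n b}"

text \<open>
  With \<open>r = v\<^sub>1 / v\<^sub>2\<close>, the matrix of \<open>b\<^sub>1\<close> acts as \<open>r \<mapsto> 1 - t r\<close>. The regions are \<open>r \<equiv> 1\<close>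
  modulo \<open>t\<close> for \<open>b\<^sub>1\<close>, negative valuation for its inverse, \<open>r \<equiv> - t\<^sup>2\<close> modulo \<open>t\<^sup>3\<close> for \<open>c\<close>, and
  valuation at least \<open>3\<close> for the inverse of \<open>c\<close>: neighbourhoods of the attracting fixed points of
  the four letters.
\<close>

definition burau_region :: "nat \<times> bool \<Rightarrow> ('b::comm_ring_1 laurent ^ 3) set" where
  "burau_region q = {v. \<exists>n a. a \<noteq> 0 \<and>
    (if fst q = 1 then lead (v $ 1) n a \<and> lead (v $ 2) n (if snd q then a else 0)
     else lead (v $ 2) n a \<and> lead (v $ 1) (n + 2) (if snd q then - a else 0))}"

lemma burau_pair_closed: "burau_pair \<in> X \<rightarrow> carrier GL"
  by (auto simp: burau_pair_def burau_red_invertible)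

lemmas lead_simps = lead_def lookup_add lookup_minus lookup_uminus distrib_right distrib_left
  left_diff_distrib right_diff_distrib mult.assoc

text \<open>
  The witnesses here and in the next lemmas are the leading exponent and coefficient of the relevant
  coordinate of the image vector, read off from the term of lowest degree in the matrix.
\<close>

lemma burau_pair_base:
  assumes "v \<in> burau_base" "x \<in> {1, 2}"
  shows "(if b then burau_pair x else inv\<^bsub>GL\<^esub> (burau_pair x)) *v v \<in> burau_region (x, b)"
proof -
  from assms obtain n a d where v: "a \<noteq> 0" "d \<noteq> 0" "lead (v $ 1) (n + 1) a" "lead (v $ 2) n d"
    by (auto simp: burau_base_def)
  from assms(2) consider "x = 1" "b" | "x = 1" "\<not> b" | "x = 2" "b" | "x = 2" "\<not> b" by blast
  then show ?thesis
  proof cases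
    case 1
    then show ?thesis using v unfolding burau_region_def
      by (intro CollectI exI[of _ n] exI[of _ d]) (simp add: burau_pair_def burau_red_b1 lead_simps)
  next
    case 2
    then show ?thesis using v unfolding burau_region_def
      by (intro CollectI exI[of _ "n - 1"] exI[of _ d]) (simp add: burau_pair_def burau_red_b1_inv lead_simps)
  next
    case 3
    then show ?thesis using v unfolding burau_region_def
      by (intro CollectI exI[of _ "n - 2"] exI[of _ a]) (simp add: burau_pair_def burau_red_c lead_simps)
  next
    case 4
    then show ?thesis using v unfolding burau_region_def
      by (intro CollectI exI[of _ "n - 1"] exI[of _ a]) (simp add: burau_pair_def burau_red_c_inv lead_simps)
  qed
qed

lemma burau_pair_step:
  assumes "v \<in> burau_region q" "x \<in> {1, 2}" "fst q \<in> {1, 2}" "q \<noteq> (x, \<not> b)"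
  shows "(if b then burau_pair x else inv\<^bsub>GL\<^esub> (burau_pair x)) *v v \<in> burau_region (x, b)"
proof -
  obtain n a where v: "a \<noteq> 0"
    "if fst q = 1 then lead (v $ 1) n a \<and> lead (v $ 2) n (if snd q then a else 0)
     else lead (v $ 2) n a \<and> lead (v $ 1) (n + 2) (if snd q then - a else 0)"
    using assms(1) by (auto simp: burau_region_def)
  have q: "q \<in> {(1, True), (1, False), (2, True), (2, False)}" using assms(3) by (cases q) auto
  from assms(2) consider "x = 1" "b" | "x = 1" "\<not> b" | "x = 2" "b" | "x = 2" "\<not> b" by blast
  then show ?thesis
  proof cases
    case 1
    then have "q \<in> {(1, True), (2, True), (2, False)}" using q assms(4) by auto
    then show ?thesis using v 1 unfolding burau_region_def
      by (intro CollectI exI[of _ n] exI[of _ a]) (elim insertE emptyE; simp add: burau_pair_def burau_red_b1 lead_simps)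
  next
    case 2
    then consider "q = (1, False)" | "q \<in> {(2, True), (2, False)}" using q assms(4) by auto
    then show ?thesis
    proof cases
      case 1
      then show ?thesis using v 2 unfolding burau_region_def
        by (intro CollectI exI[of _ "n - 1"] exI[of _ "- a"]) (simp add: burau_pair_def burau_red_b1_inv lead_simps)
    next
      case b: 2
      then show ?thesis using v 2 unfolding burau_region_def
        by (intro CollectI exI[of _ "n - 1"] exI[of _ a])
          (elim insertE emptyE; simp add: burau_pair_def burau_red_b1_inv lead_simps)
    qed
  next
    case 3
    then consider "q = (2, True)" | "q \<in> {(1, True), (1, False)}" using q assms(4) by auto
    then show ?thesis
    proof cases
      case 1
      then show ?thesis using v 3 unfolding burau_region_def
        by (intro CollectI exI[of _ "n - 1"] exI[of _ "- a"])
          (simp add: burau_pair_def burau_red_c lead_simps add.commute)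
    next
      case 2
      then show ?thesis using v 3 unfolding burau_region_def
        by (intro CollectI exI[of _ "n - 3"] exI[of _ a])
          (elim insertE emptyE; simp add: burau_pair_def burau_red_c lead_simps)
    qed
  next
    case 4
    then consider "q = (2, False)" | "q \<in> {(1, True), (1, False)}" using q assms(4) by auto
    then show ?thesis
    proof cases
      case 1
      then show ?thesis using v 4 unfolding burau_region_def
        by (intro CollectI exI[of _ n] exI[of _ a])
          (simp add: burau_pair_def burau_red_c_inv lead_simps add.commute)
    next
      case 2
      then show ?thesis using v 4 unfolding burau_region_def
        by (intro CollectI exI[of _ "n - 2"] exI[of _ a])
          (elim insertE emptyE; simp add: burau_pair_def burau_red_c_inv lead_simps)
    qed
  qed
qed

lemma lead_nonzero_unique:
  assumes "lead p n a" "lead p m b" "a \<noteq> 0" "b \<noteq> 0"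
  shows "n = m" "a = b"
  using assms by (metis lead_def linorder_neqE)+

lemma burau_region_disjoint_base:
  assumes "v \<in> burau_region q"
  shows "v \<notin> burau_base"
proof
  assume "v \<in> burau_base"
  then obtain n a b where nab: "a \<noteq> 0" "b \<noteq> 0" "lead (v $ 1) (n + 1) a" "lead (v $ 2) n b"
    by (auto simp: burau_base_def)
  from assms obtain m d where md: "d \<noteq> 0"
    "if fst q = 1 then lead (v $ 1) m d \<and> lead (v $ 2) m (if snd q then d else 0)
     else lead (v $ 2) m d \<and> lead (v $ 1) (m + 2) (if snd q then - d else 0)"
    by (auto simp: burau_region_def)
  show False
  proof (cases "fst q = 1")
    case True
    then have "lead (v $ 1) m d" using md by simp
    then have "n + 1 = m" by (rule lead_nonzero_unique(1)[OF nab(3) _ nab(1) md(1)])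
    then show False using True md nab by (auto simp: lead_def)
  next
    case False
    then have "lead (v $ 2) m d" using md by simp
    then have "n = m" by (rule lead_nonzero_unique(1)[OF nab(4) _ nab(2) md(1)])
    then show False using False md nab by (auto simp: lead_def)
  qed
qed

text \<open>
  On the ratio \<open>r = v\<^sub>1 / v\<^sub>2\<close> the braid \<open>\<sigma>\<^sub>3\<close> acts trivially, and \<open>\<xi>\<close> acts as an involution that
  maps \<open>t u\<close> to \<open>t / u\<close> up to higher order.
\<close>

lemma burau_base_invariant:
  assumes "k \<in> generate B4 {braid_sigma 3, B.\<xi>}" "v \<in> burau_base"
  shows "burau_red k *v v \<in> burau_base"
  using assms
proof (induction arbitrary: v rule: generate.induct)
  case one
  then show ?case by (simp add: burau_red_one)
next
  case (incl h)
  then obtain n a b where v: "a \<noteq> 0" "b \<noteq> 0" "lead (v $ 1) (n + 1) a" "lead (v $ 2) n b"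
    by (auto simp: burau_base_def)
  from incl(1) consider "h = braid_sigma 3" | "h = B.\<xi>" by blast
  then show ?case
  proof cases
    case 1
    then show ?thesis using incl(2) by (simp add: burau_base_def burau_red_sigma)
  next
    case 2
    then show ?thesis using v unfolding burau_base_def
      by (intro CollectI exI[of _ "n + 2"] exI[of _ b] exI[of _ a])
        (simp add: burau_red_\<xi> lead_simps add.commute)
  qed
next
  case (inv h)
  then obtain n a b where v: "a \<noteq> 0" "b \<noteq> 0" "lead (v $ 1) (n + 1) a" "lead (v $ 2) n b"
    by (auto simp: burau_base_def)
  from inv(1) consider "h = braid_sigma 3" | "h = B.\<xi>" by blast
  then show ?case
  proof cases
    case 1
    then show ?thesis using inv(2)
      by (simp add: burau_base_def burau_red_sigma burau_red_inv mat3_inverse_sigma)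
  next
    case 2
    then show ?thesis using v unfolding burau_base_def
      by (intro CollectI exI[of _ "n - 2"] exI[of _ b] exI[of _ a])
        (simp add: burau_red_inv burau_red_\<xi>_inv lead_simps)
  qed
next
  case (eng h1 h2)
  have "h1 \<in> carrier B4" "h2 \<in> carrier B4"
    using eng.hyps B.generate_in_carrier[of "{braid_sigma 3, B.\<xi>}"] by simp_all
  then show ?case using eng.IH(1)[OF eng.IH(2)[OF eng.prems]]
    by (simp add: burau_red_mult matrix_vector_mul_assoc)
qed

definition vbase :: "'b::comm_ring_1 laurent ^ 3" where
  "vbase = vector [tvar, 1, 0]"

lemma vbase: "vbase \<in> burau_base"
  unfolding burau_base_def
  by (intro CollectI exI[of _ 0] exI[of _ 1])
    (auto simp: vbase_def lead_def tvar_def lookup_single lookup_one)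

lemma burau_pair_free:
  assumes "w \<in> gwords {1..2}" "v \<in> (burau_base :: ('b::comm_ring_1 laurent ^ 3) set)"
    "word_value GL burau_pair w *v v \<in> burau_base"
  shows "(w, []) \<in> pres_rel {1..2} {}"
proof -
  have X: "{1..2} = {1, 2 :: nat}" by auto
  show ?thesis
    by (rule ping_pong_free[where f = "burau_pair :: nat \<Rightarrow> 'b laurent ^ 3 ^ 3" and V = burau_base and P = burau_region,
          OF burau_pair_closed _ _ _ assms]; unfold X)
      (use burau_region_disjoint_base in \<open>blast intro: burau_pair_base burau_pair_step\<close>)+
qed

lemma commutes_int_pow:
  fixes i :: int
  assumes "a \<in> carrier B4" "b \<in> carrier B4" "a \<otimes>\<^bsub>B4\<^esub> b = b \<otimes>\<^bsub>B4\<^esub> a"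
  shows "a \<otimes>\<^bsub>B4\<^esub> (b [^]\<^bsub>B4\<^esub> i) = (b [^]\<^bsub>B4\<^esub> i) \<otimes>\<^bsub>B4\<^esub> a"
proof -
  have "b [^]\<^bsub>B4\<^esub> i \<in> generate B4 {b}" using B.generate_pow[OF assms(2)] by blast
  then show ?thesis using B.commutes_generate[of "{b}" a] assms by simp
qed

section \<open>Faithfulness on the centralizer\<close>

lemma generate_z_\<xi>_powers:
  assumes "k \<in> generate B4 {braid_sigma 3, B.\<xi>}"
  shows "\<exists>(l::int) (m::int). k = B.\<xi> [^]\<^bsub>B4\<^esub> l \<otimes>\<^bsub>B4\<^esub> braid_sigma 3 [^]\<^bsub>B4\<^esub> m"
proof -
  let ?z = "braid_sigma 3"
  let ?k = "\<lambda>(l::int) (m::int). B.\<xi> [^]\<^bsub>B4\<^esub> l \<otimes>\<^bsub>B4\<^esub> ?z [^]\<^bsub>B4\<^esub> m"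
  have \<xi>1: "B.\<xi> \<otimes>\<^bsub>B4\<^esub> ?k l m = ?k (1 + l) m" "inv\<^bsub>B4\<^esub> B.\<xi> \<otimes>\<^bsub>B4\<^esub> ?k l m = ?k (- 1 + l) m" for l m
    using B.int_pow_mult[of B.\<xi> 1 l] B.int_pow_mult[of B.\<xi> "- 1" l]
    by (simp_all add: B.int_pow_neg flip: B.m_assoc)
  have comm: "?z \<otimes>\<^bsub>B4\<^esub> (B.\<xi> [^]\<^bsub>B4\<^esub> l) = (B.\<xi> [^]\<^bsub>B4\<^esub> l) \<otimes>\<^bsub>B4\<^esub> ?z" for l :: int
    by (rule commutes_int_pow) (simp_all add: B.z_\<xi>)
  have comm': "inv\<^bsub>B4\<^esub> ?z \<otimes>\<^bsub>B4\<^esub> (B.\<xi> [^]\<^bsub>B4\<^esub> l) = (B.\<xi> [^]\<^bsub>B4\<^esub> l) \<otimes>\<^bsub>B4\<^esub> inv\<^bsub>B4\<^esub> ?z" for l :: int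
    by (rule B.commutes_inv) (simp_all add: comm)
  have z1: "?z \<otimes>\<^bsub>B4\<^esub> ?k l m = ?k l (1 + m)" "inv\<^bsub>B4\<^esub> ?z \<otimes>\<^bsub>B4\<^esub> ?k l m = ?k l (- 1 + m)" for l m
  proof -
    have "?z \<otimes>\<^bsub>B4\<^esub> ?k l m = (B.\<xi> [^]\<^bsub>B4\<^esub> l) \<otimes>\<^bsub>B4\<^esub> (?z \<otimes>\<^bsub>B4\<^esub> (?z [^]\<^bsub>B4\<^esub> m))"
      by (simp add: comm flip: B.m_assoc)
    then show "?z \<otimes>\<^bsub>B4\<^esub> ?k l m = ?k l (1 + m)"
      using B.int_pow_mult[of ?z 1 m] by simp
    have "inv\<^bsub>B4\<^esub> ?z \<otimes>\<^bsub>B4\<^esub> ?k l m = (B.\<xi> [^]\<^bsub>B4\<^esub> l) \<otimes>\<^bsub>B4\<^esub> (inv\<^bsub>B4\<^esub> ?z \<otimes>\<^bsub>B4\<^esub> (?z [^]\<^bsub>B4\<^esub> m))"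
      by (simp add: comm' flip: B.m_assoc)
    then show "inv\<^bsub>B4\<^esub> ?z \<otimes>\<^bsub>B4\<^esub> ?k l m = ?k l (- 1 + m)"
      using B.int_pow_mult[of ?z "- 1" m] by (simp add: B.int_pow_neg)
  qed
  have "generate B4 {?z, B.\<xi>} \<subseteq> {?k l m | l m. True}"
  proof (rule B.generate_subset_of_left_closed)
    have "\<one>\<^bsub>B4\<^esub> = ?k 0 0" by simp
    then show "\<one>\<^bsub>B4\<^esub> \<in> {?k l m | l m. True}" by blast
  next
    fix k v assume "k \<in> {?z, B.\<xi>}" "v \<in> {?k l m | l m. True}"
    then show "k \<otimes>\<^bsub>B4\<^esub> v \<in> {?k l m | l m. True}" "inv\<^bsub>B4\<^esub> k \<otimes>\<^bsub>B4\<^esub> v \<in> {?k l m | l m. True}"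
      using \<xi>1 z1 by blast+
  qed auto
  then show ?thesis using assms by blast
qed

lemma matrix_vector_smult:
  fixes M :: "'a::comm_ring_1 ^ 'n ^ 'm"
  shows "M *v (r *s v) = r *s (M *v v)"
  by (simp add: vec_eq_iff matrix_vector_mult_def sum_distrib_left mult.left_commute)

lemma eigenvector_int_pow:
  fixes M :: "'b::comm_ring_1 laurent ^ 'n ^ 'n" and i :: int
  assumes M: "invertible M" and Mv: "M *v v = Poly_Mapping.single d 1 *s v"
  shows "(M [^]\<^bsub>GL\<^esub> i) *v v = Poly_Mapping.single (d * i) 1 *s v"
proof -
  interpret GLn: group "GL :: ('b laurent ^ 'n ^ 'n) monoid" by (rule group_GL)
  have nat: "(M [^]\<^bsub>GL\<^esub> n) *v v = Poly_Mapping.single (d * int n) 1 *s v" for n :: nat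
  proof (induction n)
    case (Suc n)
    have "(M [^]\<^bsub>GL\<^esub> Suc n) *v v = (M [^]\<^bsub>GL\<^esub> n) *v (M *v v)"
      by (simp add: matrix_vector_mul_assoc)
    also have "\<dots> = Poly_Mapping.single d 1 *s ((M [^]\<^bsub>GL\<^esub> n) *v v)"
      by (simp add: Mv matrix_vector_smult)
    also have "\<dots> = Poly_Mapping.single (d * int (Suc n)) 1 *s v"
      by (simp add: Suc.IH vector_smult_assoc mult_single distrib_left)
    finally show ?case .
  qed (simp add: vector_smult_lid single_one)
  show ?thesis
  proof (cases i rule: int_cases2)
    case (nonneg n)
    then show ?thesis using nat[of n] by (simp add: int_pow_int)
  next
    case (nonpos n)
    let ?A = "M [^]\<^bsub>GL\<^esub> n"
    have A: "?A \<in> carrier GL" using M by (intro GLn.nat_pow_closed) simp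
    have "inv\<^bsub>GL\<^esub> ?A ** ?A = mat 1" using GLn.l_inv[OF A] by simp
    then have "v = inv\<^bsub>GL\<^esub> ?A *v (?A *v v)" by (simp add: matrix_vector_mul_assoc)
    also have "\<dots> = Poly_Mapping.single (d * int n) 1 *s (inv\<^bsub>GL\<^esub> ?A *v v)"
      by (simp add: nat matrix_vector_smult)
    finally have "Poly_Mapping.single (d * i) 1 *s v =
        Poly_Mapping.single (d * i) 1 *s (Poly_Mapping.single (d * int n) 1 *s (inv\<^bsub>GL\<^esub> ?A *v v))"
      by simp
    also have "\<dots> = inv\<^bsub>GL\<^esub> ?A *v v"
      by (simp add: vector_smult_assoc mult_single nonpos single_one vector_smult_lid)
    finally show ?thesis using M by (simp add: nonpos GLn.int_pow_neg_int)
  qed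
qed

text \<open>
  If \<open>k = \<xi>\<^sup>l \<sigma>\<^sub>3\<^sup>m\<close>, then the first and the third basis vector are eigenvectors of the matrix of
  \<open>k\<^sup>2\<close>, with eigenvalues \<open>t\<^sup>4\<^sup>l\<close> and \<open>t\<^sup>4\<^sup>l\<^sup>+\<^sup>2\<^sup>m\<close>; passing to the square removes the signs.
\<close>

lemma burau_red_faithful_z_\<xi>:
  assumes k: "k \<in> generate B4 {braid_sigma 3, B.\<xi>}"
    and 1: "burau_red k = (mat 1 :: 'b::comm_ring_1 laurent ^ 3 ^ 3)"
  shows "k = \<one>\<^bsub>B4\<^esub>"
proof -
  let ?z = "braid_sigma 3"
  let ?\<beta> = "burau_red :: nat gword set \<Rightarrow> 'b laurent ^ 3 ^ 3"
  obtain l m :: int where lm: "k = B.\<xi> [^]\<^bsub>B4\<^esub> l \<otimes>\<^bsub>B4\<^esub> ?z [^]\<^bsub>B4\<^esub> m"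
    using generate_z_\<xi>_powers[OF k] by blast
  let ?X = "B.\<xi> \<otimes>\<^bsub>B4\<^esub> B.\<xi>" and ?Z = "?z \<otimes>\<^bsub>B4\<^esub> ?z"
  have kc: "k \<in> carrier B4" using B.generate_in_carrier[OF _ k] by simp
  have pz: "B.\<xi> [^]\<^bsub>B4\<^esub> l \<otimes>\<^bsub>B4\<^esub> ?z [^]\<^bsub>B4\<^esub> m = ?z [^]\<^bsub>B4\<^esub> m \<otimes>\<^bsub>B4\<^esub> B.\<xi> [^]\<^bsub>B4\<^esub> l"
  proof (rule commutes_int_pow)
    show "B.\<xi> [^]\<^bsub>B4\<^esub> l \<otimes>\<^bsub>B4\<^esub> ?z = ?z \<otimes>\<^bsub>B4\<^esub> B.\<xi> [^]\<^bsub>B4\<^esub> l"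
      by (rule commutes_int_pow[symmetric]) (simp_all add: B.z_\<xi>)
  qed simp_all
  have "k \<otimes>\<^bsub>B4\<^esub> k = B.\<xi> [^]\<^bsub>B4\<^esub> l \<otimes>\<^bsub>B4\<^esub> (?z [^]\<^bsub>B4\<^esub> m \<otimes>\<^bsub>B4\<^esub> B.\<xi> [^]\<^bsub>B4\<^esub> l) \<otimes>\<^bsub>B4\<^esub> ?z [^]\<^bsub>B4\<^esub> m"
    by (simp add: lm B.m_assoc)
  also have "\<dots> = (B.\<xi> [^]\<^bsub>B4\<^esub> l \<otimes>\<^bsub>B4\<^esub> B.\<xi> [^]\<^bsub>B4\<^esub> l) \<otimes>\<^bsub>B4\<^esub> (?z [^]\<^bsub>B4\<^esub> m \<otimes>\<^bsub>B4\<^esub> ?z [^]\<^bsub>B4\<^esub> m)"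
    unfolding pz[symmetric] by (simp add: B.m_assoc)
  also have "\<dots> = ?X [^]\<^bsub>B4\<^esub> l \<otimes>\<^bsub>B4\<^esub> ?Z [^]\<^bsub>B4\<^esub> m"
    by (simp add: B.int_pow_mult_distrib)
  finally have k2: "k \<otimes>\<^bsub>B4\<^esub> k = ?X [^]\<^bsub>B4\<^esub> l \<otimes>\<^bsub>B4\<^esub> ?Z [^]\<^bsub>B4\<^esub> m" .
  have "?\<beta> (k \<otimes>\<^bsub>B4\<^esub> k) = mat 1" using kc 1 by (simp add: burau_red_mult)
  then have kk: "?\<beta> (?X [^]\<^bsub>B4\<^esub> l) ** ?\<beta> (?Z [^]\<^bsub>B4\<^esub> m) = mat 1"
    unfolding k2 by (subst (asm) burau_red_mult) simp_all
  have pow: "?\<beta> (g [^]\<^bsub>B4\<^esub> i) = ?\<beta> g [^]\<^bsub>GL\<^esub> i" if "g \<in> carrier B4" for g and i :: int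
    by (rule hom_int_pow[OF burau_red_hom that group_braid_group group_GL])
  have X: "?\<beta> (?X [^]\<^bsub>B4\<^esub> l) *v v = Poly_Mapping.single (4 * l) 1 *s v" for v
    using eigenvector_int_pow[OF burau_red_invertible burau_red_\<xi>2, of l v] by (simp add: pow)
  have Z: "?\<beta> (?Z [^]\<^bsub>B4\<^esub> m) *v v = Poly_Mapping.single (d * m) 1 *s v"
    if "?\<beta> ?Z *v v = Poly_Mapping.single d 1 *s v" for v d
    using eigenvector_int_pow[OF burau_red_invertible that, of m] by (simp add: pow)
  have XZ: "v = Poly_Mapping.single (4 * l + d * m) 1 *s v"
    if "?\<beta> ?Z *v v = Poly_Mapping.single d 1 *s v" for v d
  proof -
    have "v = ?\<beta> (?X [^]\<^bsub>B4\<^esub> l) *v (?\<beta> (?Z [^]\<^bsub>B4\<^esub> m) *v v)"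
      by (simp add: matrix_vector_mul_assoc kk)
    then show ?thesis by (simp add: X Z[OF that] vector_smult_assoc mult_single)
  qed
  have zz: "?\<beta> ?Z = mat3 1 0 0 0 1 0 0 (tvar - tvar * tvar) (tvar * tvar)"
    by (simp add: burau_red_mult burau_red_sigma)
  have t2: "tvar * tvar = (Poly_Mapping.single 2 1 :: 'b laurent)"
    by (simp add: tvar_def mult_single)
  let ?e1 = "vector [1, 0, 0] :: 'b laurent ^ 3" and ?e3 = "vector [0, 0, 1] :: 'b laurent ^ 3"
  have "?\<beta> ?Z *v ?e1 = Poly_Mapping.single 0 1 *s ?e1" "?\<beta> ?Z *v ?e3 = Poly_Mapping.single 2 1 *s ?e3"
    unfolding zz by (simp_all add: vec_eq_iff forall_3 single_one t2)
  from this[THEN XZ] have "?e1 = Poly_Mapping.single (4 * l) 1 *s ?e1"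
    "?e3 = Poly_Mapping.single (4 * l + 2 * m) 1 *s ?e3" by simp_all
  from arg_cong[OF this(1), of "\<lambda>v. v $ 1"] arg_cong[OF this(2), of "\<lambda>v. v $ 3"]
  have eqs: "Poly_Mapping.single (4 * l) (1::'b) = 1" "Poly_Mapping.single (4 * l + 2 * m) (1::'b) = 1"
    by simp_all
  have "l = 0" "m = 0"
    using single_eq_1[OF eqs(1)] single_eq_1[OF eqs(2)] by simp_all
  then show ?thesis by (simp add: lm)
qed

lemma word_value_hom:
  assumes "group G" "group H" "h \<in> hom G H" "f \<in> X \<rightarrow> carrier G" "w \<in> gwords X"
  shows "h (word_value G f w) = word_value H (h \<circ> f) w"
proof -
  interpret group_hom G H h
    by (intro group_hom.intro group_hom_axioms.intro assms)
  show ?thesis using assms(5)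
  proof (induction w)
    case (Cons p w)
    then show ?case using G.word_value_closed[OF assms(4)] assms(4) by (cases p) (auto simp: Pi_iff)
  qed simp
qed

text \<open>
  If \<open>f k\<close> acts trivially, then \<open>f\<close> sends the image under \<open>k\<close> of a base vector, which is again a
  base vector, back to a base vector, and ping-pong makes \<open>f\<close> trivial.
\<close>

lemma burau_red_kernel:
  assumes g: "g \<in> centralizer B4 (braid_sigma 3)"
    and 1: "burau_red g = (mat 1 :: 'b::comm_ring_1 laurent ^ 3 ^ 3)"
  shows "g = \<one>\<^bsub>B4\<^esub>"
proof -
  let ?\<beta> = "burau_red :: nat gword set \<Rightarrow> 'b laurent ^ 3 ^ 3"
  let ?f = "\<lambda>i::nat. if i = 1 then B.b1 else B.c"
  obtain f k where f: "f \<in> generate B4 {B.b1, B.c}" and k: "k \<in> generate B4 {braid_sigma 3, B.\<xi>}"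
    and gfk: "g = f \<otimes>\<^bsub>B4\<^esub> k"
    using centralizer_factorization[OF g] by blast
  have kc: "k \<in> carrier B4" using B.generate_in_carrier[OF _ k] by simp
  have fc: "?f \<in> X \<rightarrow> carrier B4" for X by simp
  have "?f ` {1..2} = {B.b1, B.c}" by (force simp: image_iff)
  then obtain w where w: "w \<in> gwords {1..2}" "f = word_value B4 ?f w"
    using f B.generate_eq_word_values[OF fc, of "{1..2}"] by (simp only:) blast
  have \<beta>f: "?\<beta> f = word_value GL burau_pair w"
    unfolding w(2) word_value_hom[OF group_braid_group group_GL burau_red_hom fc w(1)]
    by (rule arg_cong[of _ _ "\<lambda>f. word_value GL f w"]) (simp add: fun_eq_iff burau_pair_def)
  have "f \<in> carrier B4" unfolding w(2) by (rule B.word_value_closed[OF fc w(1)])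
  then have "word_value GL burau_pair w *v (?\<beta> k *v vbase) = vbase"
    using 1 kc by (simp add: gfk burau_red_mult \<beta>f matrix_vector_mul_assoc)
  then have "word_value GL burau_pair w *v (?\<beta> k *v vbase) \<in> burau_base" using vbase by simp
  then have "(w, []) \<in> pres_rel {1..2} {}"
    by (rule burau_pair_free[OF w(1) burau_base_invariant[OF k vbase]])
  then have "word_value B4 ?f w = word_value B4 ?f []"
    by (rule B.word_value_pres_rel[OF fc, rotated]) simp
  then have "f = \<one>\<^bsub>B4\<^esub>" using w(2) by simp
  then have "g = k" using gfk kc by simp
  then show ?thesis using burau_red_faithful_z_\<xi>[OF k] 1 by simp
qed

lemma burau_red_mon:
  "(burau_red :: nat gword set \<Rightarrow> 'b::comm_ring_1 laurent ^ 3 ^ 3)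
    \<in> mon (B4\<lparr>carrier := centralizer B4 (braid_sigma 3)\<rparr>) GL"
proof -
  let ?C = "centralizer B4 (braid_sigma 3)"
  let ?\<beta> = "burau_red :: nat gword set \<Rightarrow> 'b laurent ^ 3 ^ 3"
  have C: "?C \<subseteq> carrier B4" by (auto simp: centralizer_def)
  have "inj_on ?\<beta> ?C"
  proof (rule inj_onI)
    fix g h assume g: "g \<in> ?C" and h: "h \<in> ?C" and eq: "?\<beta> g = ?\<beta> h"
    have gh: "g \<in> carrier B4" "h \<in> carrier B4" using g h C by auto
    let ?z = "braid_sigma 3" and ?h = "inv\<^bsub>B4\<^esub> h"
    have hz: "?h \<otimes>\<^bsub>B4\<^esub> ?z = ?z \<otimes>\<^bsub>B4\<^esub> ?h"
      using h by (intro B.commutes_inv) (auto simp: centralizer_def)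
    have "g \<otimes>\<^bsub>B4\<^esub> ?h \<otimes>\<^bsub>B4\<^esub> ?z = (g \<otimes>\<^bsub>B4\<^esub> ?z) \<otimes>\<^bsub>B4\<^esub> ?h"
      using gh by (simp add: B.m_assoc hz)
    also have "\<dots> = ?z \<otimes>\<^bsub>B4\<^esub> (g \<otimes>\<^bsub>B4\<^esub> ?h)"
      using g gh by (simp add: centralizer_def B.m_assoc)
    finally have "g \<otimes>\<^bsub>B4\<^esub> ?h \<in> ?C" using gh by (simp add: centralizer_def)
    moreover have "?\<beta> (g \<otimes>\<^bsub>B4\<^esub> ?h) = ?\<beta> (h \<otimes>\<^bsub>B4\<^esub> ?h)"
      using gh by (simp only: burau_red_mult B.inv_closed eq)
    then have "?\<beta> (g \<otimes>\<^bsub>B4\<^esub> inv\<^bsub>B4\<^esub> h) = mat 1"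
      using gh by (simp add: burau_red_one)
    ultimately have "g \<otimes>\<^bsub>B4\<^esub> inv\<^bsub>B4\<^esub> h = \<one>\<^bsub>B4\<^esub>" by (rule burau_red_kernel)
    then show "g = h" using gh B.inv_equality[of g "inv\<^bsub>B4\<^esub> h"] by simp
  qed
  moreover have "?\<beta> \<in> hom (B4\<lparr>carrier := ?C\<rparr>) GL"
    using burau_red_hom C by (auto simp: hom_def subset_iff)
  ultimately show ?thesis by (simp add: mon_def)
qed

lemma burau_pair_generate_free:
  "subgroup_generated GL {burau_pair 1, burau_pair 2 :: 'b::comm_ring_1 laurent ^ 3 ^ 3} \<cong> free_group {1..2::nat}"
proof -
  let ?G = "GL :: ('b laurent ^ 3 ^ 3) monoid" and ?burau_pair = "burau_pair :: nat \<Rightarrow> 'b laurent ^ 3 ^ 3"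
  let ?F = "free_group {1..2::nat}" and ?S = "subgroup_generated ?G {burau_pair 1, burau_pair 2}"
  let ?\<phi> = "pres_lift ?G ?burau_pair"
  interpret G: group ?G by (rule group_GL)
  have F: "group ?F" unfolding free_group_def by (rule group_presented_group)
  have cls: "?\<phi> (pres_rel {1..2} {} `` {w}) = word_value ?G burau_pair w" if "w \<in> gwords {1..2}" for w
    by (rule G.pres_lift_class[OF burau_pair_closed _ that]) simp
  have hom: "?\<phi> \<in> hom ?F ?G"
    unfolding free_group_def by (rule G.pres_lift(1)[OF burau_pair_closed]) simp
  have "burau_pair ` {1..2} = {burau_pair 1, burau_pair 2 :: 'b laurent ^ 3 ^ 3}" 
  proof -
    have "{1..2} = {1, 2::nat}" by auto
    then show ?thesis by simp
  qed
  moreover have "carrier ?G \<inter> {burau_pair 1, burau_pair 2} = {burau_pair 1, burau_pair 2}"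
    using burau_pair_closed[of UNIV] by auto
  ultimately have carr: "carrier ?S = word_value ?G burau_pair ` gwords {1..2}"
    using G.generate_eq_word_values[OF burau_pair_closed, of "{1..2}"]
    by (simp only: carrier_subgroup_generated)
  have image: "?\<phi> ` carrier ?F = carrier ?S"
  proof
    show "?\<phi> ` carrier ?F \<subseteq> carrier ?S"
      unfolding carr free_group_def by (auto elim!: presented_group_cases simp: cls)
    show "carrier ?S \<subseteq> ?\<phi> ` carrier ?F"
      unfolding carr free_group_def
      using cls presented_group_carrier_class by (force simp: image_iff)
  qed
  have "?\<phi> \<in> hom ?F ?S"
    using hom image by (auto simp: hom_def)
  moreover have "inj_on ?\<phi> (carrier ?F)"
    unfolding inj_on_one_iff'[OF hom F group_GL]
  proof (intro allI impI)
    fix A assume A: "A \<in> carrier ?F" "?\<phi> A = \<one>\<^bsub>?G\<^esub>"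
    then obtain w where w: "w \<in> gwords {1..2}" "A = pres_rel {1..2} {} `` {w}"
      unfolding free_group_def by (auto elim: presented_group_cases)
    have "word_value ?G burau_pair w *v vbase \<in> burau_base" using A(2) w cls vbase by simp
    then have "(w, []) \<in> pres_rel {1..2} {}" by (rule burau_pair_free[OF w(1) vbase])
    then show "A = \<one>\<^bsub>?F\<^esub>"
      unfolding w(2) free_group_def using pres_class_eq by (simp add: presented_group_def) 
  qed
  ultimately have "?\<phi> \<in> iso ?F ?S" using image by (simp add: iso_def bij_betw_def)
  then have "?F \<cong> ?S" by (auto simp: is_iso_def)
  then show ?thesis by (rule group.iso_sym[OF F])
qed

theorem theorem1p3:
  shows "burau4 \<in> mon (B4\<lparr>carrier := centralizer B4 (braid_sigma 3)\<rparr>) GL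
    \<and> (reduce_mat :: int laurent ^ 3 ^ 3 \<Rightarrow> 'p::prime_card mod_ring laurent ^ 3 ^ 3) \<circ> burau4
        \<in> mon (B4\<lparr>carrier := centralizer B4 (braid_sigma 3)\<rparr>) GL
    \<and> subgroup_generated (GL :: ('p mod_ring laurent ^ 3 ^ 3) monoid)
          {reduce_mat burau_S, reduce_mat (burau_T \<otimes>\<^bsub>GL\<^esub> burau_S \<otimes>\<^bsub>GL\<^esub> inv\<^bsub>GL\<^esub> burau_T)}
        \<cong> free_group {1..2::nat}"
proof (intro conjI)
  let ?C = "centralizer B4 (braid_sigma 3)"
  let ?\<rho> = "reduce_mat :: int laurent ^ 3 ^ 3 \<Rightarrow> 'p mod_ring laurent ^ 3 ^ 3"
  show mod_p: "?\<rho> \<circ> burau4 \<in> mon (B4\<lparr>carrier := ?C\<rparr>) GL"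
    using burau_red_mon unfolding burau_red_def .
  have "inj_on burau4 ?C"
    using mod_p by (auto simp: mon_def intro: inj_on_imageI2)
  moreover have "burau4 \<in> hom (B4\<lparr>carrier := ?C\<rparr>) GL"
    using burau4_hom by (auto simp: hom_def centralizer_def)
  ultimately show "burau4 \<in> mon (B4\<lparr>carrier := ?C\<rparr>) GL" by (simp add: mon_def)
  have inv: "burau4 (inv\<^bsub>B4\<^esub> B.b2) = inv\<^bsub>GL\<^esub> (burau4 B.b2)"
    by (rule group_hom.hom_inv[OF group_hom.intro[OF group_braid_group group_GL
          group_hom_axioms.intro[OF burau4_hom]]]) simp
  have "burau_T \<otimes>\<^bsub>GL\<^esub> burau_S \<otimes>\<^bsub>GL\<^esub> inv\<^bsub>GL\<^esub> burau_T = burau4 B.c"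
    unfolding burau_S_def burau_T_def B.c_def B_b1[symmetric] B_b2[symmetric] inv[symmetric]
    using hom_mult[OF burau4_hom] by simp
  then have "?\<rho> (burau_T \<otimes>\<^bsub>GL\<^esub> burau_S \<otimes>\<^bsub>GL\<^esub> inv\<^bsub>GL\<^esub> burau_T) = burau_pair 2"
    by (simp add: burau_pair_def burau_red_def)
  moreover have "?\<rho> burau_S = burau_pair 1"
    by (simp add: burau_pair_def burau_red_def burau_S_def B_b1)
  ultimately show "subgroup_generated (GL :: ('p mod_ring laurent ^ 3 ^ 3) monoid)
      {?\<rho> burau_S, ?\<rho> (burau_T \<otimes>\<^bsub>GL\<^esub> burau_S \<otimes>\<^bsub>GL\<^esub> inv\<^bsub>GL\<^esub> burau_T)}
    \<cong> free_group {1..2::nat}"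
    using burau_pair_generate_free by simp
qed

end
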